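(* Over a field $\mathbb K$ of characteristic not equal to $2$, the operad $\mathrm{Lie}\text{-}\mathrm{adm}$ of Lie-admissible algebras is isomorphic to the free product $\mathrm{Lie}\ast\mathrm{Com}$, where $\mathrm{Lie}$ is the operad of Lie algebras and $\mathrm{Com}$ is the operad of commutative (not necessarily associative) algebras.
   Context: Operads are symmetric operads of vector spaces over $\mathbb K$, with components $\mathcal P(n)$, $n\ge1$. Free product: $\mathcal O_1\ast\mathcal O_2$ is an operad $\mathcal O$ with morphisms $\pi_i:\mathcal O_i\to\mathcal O$, $i=1,2$, such that for every operad $\mathcal P$ and every pair of morphisms $\psi_i:\mathcal O_i\to\mathcal P$ there is a unique morphism $\psi:\mathcal O\to\mathcal P$ with $\psi_i=\psi\pi_i$ for $i=1,2$. $\mathrm{Com}$ is the free operad generated by one commutative binary operation (i.e. by the one-dimensional trivial $S_2$-module in arity $2$), with no further relations; in particular associativity is not imposed. $\mathrm{Lie}$ is the operad generated by one skew-symmetric binary operation (the one-dimensional sign $S_2$-module in arity $2$) subject to the Jacobi identity. A Lie-admissible algebra is a vector space with a bilinear product $(a,b)\mapsto ab$ such that $$(ab)c=(ba)c+c(ab)-c(ba)-(bc)a+(cb)a+a(bc)-a(cb)-(ca)b+(ac)b+b(ca)-b(ac)$$ for all $a,b,c$; equivalently, the commutator $[a,b]=ab-ba$ satisfies the Jacobi identity. $\mathrm{Lie}\text{-}\mathrm{adm}$ is the operad governing such algebras: it is generated by one binary operation without symmetry (the two-dimensional regular $S_2$-module in arity $2$) subject to this identity. *)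

theory Defs
  imports
    "HOL-Algebra.Algebraic_Closure_Type"
    "HOL-Algebra.Module"
    "HOL-Algebra.QuotRing"
    "HOL-Library.Poly_Mapping"
begin

section \<open>Symmetric operads\<close>

text \<open>
  The components of an operad are modules, in the sense of HOL-Algebra, over the ground field
  \<open>'k\<close>; only the arities \<open>n \<ge> 1\<close> matter.  The fields \<open>mult\<close> and \<open>one\<close> that the module record
  inherits from rings are never used.

  \<open>pcomp P m n i f g\<close> is the partial composition
  \<open>f(x\<^sub>1, \<dots>, x\<^bsub>i-1\<^esub>, g(x\<^sub>i, \<dots>, x\<^bsub>i+n-1\<^esub>), x\<^bsub>i+n\<^esub>, \<dots>)\<close> of \<open>f\<close> in arity \<open>m\<close> and \<open>g\<close> in arity \<open>n\<close>.

  \<open>act P n \<sigma>\<close> is the left action \<open>(\<sigma> f)(x\<^sub>1, \<dots>, x\<^sub>n) = f(x\<^bsub>\<sigma> 1\<^esub>, \<dots>, x\<^bsub>\<sigma> n\<^esub>)\<close>; the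
  usual right action is recovered as \<open>f \<sigma> = \<sigma>\<^sup>-\<^sup>1 f\<close>.
\<close>

record ('k, 'a) operad =
  cpt :: "nat \<Rightarrow> ('k, 'a) module"
  act :: "nat \<Rightarrow> (nat \<Rightarrow> nat) \<Rightarrow> 'a \<Rightarrow> 'a"
  ident :: 'a
  pcomp :: "nat \<Rightarrow> nat \<Rightarrow> nat \<Rightarrow> 'a \<Rightarrow> 'a \<Rightarrow> 'a"

abbreviation elems :: "('k, 'a) operad \<Rightarrow> nat \<Rightarrow> 'a set" where
  "elems P n \<equiv> carrier (cpt P n)"

definition linear_map :: "('k, 'a) module \<Rightarrow> ('k, 'b) module \<Rightarrow> ('a \<Rightarrow> 'b) \<Rightarrow> bool" where
  "linear_map M N f \<longleftrightarrow>
     f \<in> carrier M \<rightarrow> carrier N \<and>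
     (\<forall>x\<in>carrier M. \<forall>y\<in>carrier M. f (x \<oplus>\<^bsub>M\<^esub> y) = f x \<oplus>\<^bsub>N\<^esub> f y) \<and>
     (\<forall>c. \<forall>x\<in>carrier M. f (c \<odot>\<^bsub>M\<^esub> x) = c \<odot>\<^bsub>N\<^esub> f x)"

text \<open>
  If \<open>\<sigma>\<close> permutes the inputs of \<open>f\<close> and \<open>\<tau>\<close> those of \<open>g\<close>, where \<open>g\<close> has arity \<open>n\<close>, then
  \<open>block_perm n i \<sigma> \<tau>\<close> is the induced permutation of the inputs of the composition of \<open>f\<close> and
  \<open>g\<close> at input \<open>i\<close>: input \<open>i\<close> of \<open>f\<close> is a block of length \<open>n\<close>, permuted internally by \<open>\<tau>\<close>,
  and this block becomes input \<open>\<sigma> i\<close> of \<open>\<sigma> f\<close>.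
\<close>

definition skip_block :: "nat \<Rightarrow> nat \<Rightarrow> nat \<Rightarrow> nat" where
  "skip_block n i j = (if j < i then j else j + n - 1)"

definition block_perm :: "nat \<Rightarrow> nat \<Rightarrow> (nat \<Rightarrow> nat) \<Rightarrow> (nat \<Rightarrow> nat) \<Rightarrow> nat \<Rightarrow> nat" where
  "block_perm n i \<sigma> \<tau> p =
     (if p < i then skip_block n (\<sigma> i) (\<sigma> p)
      else if p < i + n then \<sigma> i + \<tau> (p - i + 1) - 1
      else skip_block n (\<sigma> i) (\<sigma> (p - n + 1)))"

locale operad =
  fixes P :: "('k::field, 'a) operad"
  assumes cpt_module: "1 \<le> n \<Longrightarrow> module (ring_of_type_algebra :: 'k ring) (cpt P n)"
    and act_linear: "1 \<le> n \<Longrightarrow> \<sigma> permutes {1..n} \<Longrightarrow> linear_map (cpt P n) (cpt P n) (act P n \<sigma>)"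
    and act_id: "1 \<le> n \<Longrightarrow> f \<in> elems P n \<Longrightarrow> act P n id f = f"
    and act_comp: "1 \<le> n \<Longrightarrow> \<sigma> permutes {1..n} \<Longrightarrow> \<tau> permutes {1..n} \<Longrightarrow> f \<in> elems P n \<Longrightarrow>
      act P n (\<sigma> \<circ> \<tau>) f = act P n \<sigma> (act P n \<tau> f)"
    and ident_closed: "ident P \<in> elems P 1"
    and pcomp_linear_left: "i \<in> {1..m} \<Longrightarrow> 1 \<le> n \<Longrightarrow> g \<in> elems P n \<Longrightarrow>
      linear_map (cpt P m) (cpt P (m + n - 1)) (\<lambda>f. pcomp P m n i f g)"
    and pcomp_linear_right: "i \<in> {1..m} \<Longrightarrow> 1 \<le> n \<Longrightarrow> f \<in> elems P m \<Longrightarrow>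
      linear_map (cpt P n) (cpt P (m + n - 1)) (\<lambda>g. pcomp P m n i f g)"
    and ident_left: "1 \<le> n \<Longrightarrow> f \<in> elems P n \<Longrightarrow> pcomp P 1 n 1 (ident P) f = f"
    and ident_right: "i \<in> {1..n} \<Longrightarrow> f \<in> elems P n \<Longrightarrow> pcomp P n 1 i f (ident P) = f"
    and assoc_sequential: "i \<in> {1..l} \<Longrightarrow> j \<in> {1..m} \<Longrightarrow> 1 \<le> n \<Longrightarrow>
      f \<in> elems P l \<Longrightarrow> g \<in> elems P m \<Longrightarrow> h \<in> elems P n \<Longrightarrow>
      pcomp P (l + m - 1) n (i + j - 1) (pcomp P l m i f g) h =
      pcomp P l (m + n - 1) i f (pcomp P m n j g h)"
    and assoc_parallel: "i \<in> {1..l} \<Longrightarrow> j \<in> {1..l} \<Longrightarrow> i < j \<Longrightarrow> 1 \<le> m \<Longrightarrow> 1 \<le> n \<Longrightarrow>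
      f \<in> elems P l \<Longrightarrow> g \<in> elems P m \<Longrightarrow> h \<in> elems P n \<Longrightarrow>
      pcomp P (l + m - 1) n (j + m - 1) (pcomp P l m i f g) h =
      pcomp P (l + n - 1) m i (pcomp P l n j f h) g"
    and equivariant: "i \<in> {1..m} \<Longrightarrow> 1 \<le> n \<Longrightarrow> \<sigma> permutes {1..m} \<Longrightarrow> \<tau> permutes {1..n} \<Longrightarrow>
      f \<in> elems P m \<Longrightarrow> g \<in> elems P n \<Longrightarrow>
      pcomp P m n (\<sigma> i) (act P m \<sigma> f) (act P n \<tau> g) =
      act P (m + n - 1) (block_perm n i \<sigma> \<tau>) (pcomp P m n i f g)"

definition operad_hom ::
    "('k::field, 'a) operad \<Rightarrow> ('k, 'b) operad \<Rightarrow> (nat \<Rightarrow> 'a \<Rightarrow> 'b) \<Rightarrow> bool" where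
  "operad_hom P Q \<phi> \<longleftrightarrow>
     (\<forall>n\<ge>1. linear_map (cpt P n) (cpt Q n) (\<phi> n)) \<and>
     (\<forall>n\<ge>1. \<forall>\<sigma>. \<sigma> permutes {1..n} \<longrightarrow>
        (\<forall>f\<in>elems P n. \<phi> n (act P n \<sigma> f) = act Q n \<sigma> (\<phi> n f))) \<and>
     \<phi> 1 (ident P) = ident Q \<and>
     (\<forall>m\<ge>1. \<forall>n\<ge>1. \<forall>i\<in>{1..m}. \<forall>f\<in>elems P m. \<forall>g\<in>elems P n.
        \<phi> (m + n - 1) (pcomp P m n i f g) = pcomp Q m n i (\<phi> m f) (\<phi> n g))"

definition operad_isomorphic :: "('k::field, 'a) operad \<Rightarrow> ('k, 'b) operad \<Rightarrow> bool" where
  "operad_isomorphic P Q \<longleftrightarrow>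
     (\<exists>\<phi>. operad_hom P Q \<phi> \<and> (\<forall>n\<ge>1. bij_betw (\<phi> n) (elems P n) (elems Q n)))"

definition hom_eq :: "('k, 'a) operad \<Rightarrow> (nat \<Rightarrow> 'a \<Rightarrow> 'b) \<Rightarrow> (nat \<Rightarrow> 'a \<Rightarrow> 'b) \<Rightarrow> bool" where
  "hom_eq P \<phi> \<psi> \<longleftrightarrow> (\<forall>n\<ge>1. \<forall>f\<in>elems P n. \<phi> n f = \<psi> n f)"

text \<open>
  The universal property quantifies over all operads \<open>P\<close> whose elements live in the type \<open>'p\<close>;
  the type argument makes \<open>'p\<close> visible, since HOL cannot quantify over types inside a formula.
\<close>

definition is_free_product ::
    "'p itself \<Rightarrow> ('k::field, 'a) operad \<Rightarrow> ('k, 'b) operad \<Rightarrow> ('k, 'c) operad \<Rightarrow>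
     (nat \<Rightarrow> 'a \<Rightarrow> 'c) \<Rightarrow> (nat \<Rightarrow> 'b \<Rightarrow> 'c) \<Rightarrow> bool" where
  "is_free_product (_ :: 'p itself) O\<^sub>1 O\<^sub>2 F \<pi>\<^sub>1 \<pi>\<^sub>2 \<longleftrightarrow>
     operad O\<^sub>1 \<and> operad O\<^sub>2 \<and> operad F \<and> operad_hom O\<^sub>1 F \<pi>\<^sub>1 \<and> operad_hom O\<^sub>2 F \<pi>\<^sub>2 \<and>
     (\<forall>(P :: ('k, 'p) operad) \<psi>\<^sub>1 \<psi>\<^sub>2.
        operad P \<and> operad_hom O\<^sub>1 P \<psi>\<^sub>1 \<and> operad_hom O\<^sub>2 P \<psi>\<^sub>2 \<longrightarrow>
        (\<exists>\<psi>. operad_hom F P \<psi> \<and>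
           hom_eq O\<^sub>1 \<psi>\<^sub>1 (\<lambda>n f. \<psi> n (\<pi>\<^sub>1 n f)) \<and> hom_eq O\<^sub>2 \<psi>\<^sub>2 (\<lambda>n f. \<psi> n (\<pi>\<^sub>2 n f)) \<and>
           (\<forall>\<psi>'. operad_hom F P \<psi>' \<and>
              hom_eq O\<^sub>1 \<psi>\<^sub>1 (\<lambda>n f. \<psi>' n (\<pi>\<^sub>1 n f)) \<and> hom_eq O\<^sub>2 \<psi>\<^sub>2 (\<lambda>n f. \<psi>' n (\<pi>\<^sub>2 n f)) \<longrightarrow>
              hom_eq F \<psi>' \<psi>)))"


section \<open>Operadic ideals and quotients\<close>

inductive in_ideal :: "('k, 'a) operad \<Rightarrow> (nat \<Rightarrow> 'a set) \<Rightarrow> nat \<Rightarrow> 'a \<Rightarrow> bool"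
  for P :: "('k, 'a) operad" and R :: "nat \<Rightarrow> 'a set" where
  generator: "f \<in> R n \<Longrightarrow> in_ideal P R n f"
| zero: "in_ideal P R n \<zero>\<^bsub>cpt P n\<^esub>"
| add: "in_ideal P R n f \<Longrightarrow> in_ideal P R n g \<Longrightarrow> in_ideal P R n (f \<oplus>\<^bsub>cpt P n\<^esub> g)"
| smult: "in_ideal P R n f \<Longrightarrow> in_ideal P R n (c \<odot>\<^bsub>cpt P n\<^esub> f)"
| act: "in_ideal P R n f \<Longrightarrow> \<sigma> permutes {1..n} \<Longrightarrow> in_ideal P R n (act P n \<sigma> f)"
| pcomp_left: "in_ideal P R m f \<Longrightarrow> i \<in> {1..m} \<Longrightarrow> 1 \<le> n \<Longrightarrow> g \<in> elems P n \<Longrightarrow>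
    in_ideal P R (m + n - 1) (pcomp P m n i f g)"
| pcomp_right: "f \<in> elems P m \<Longrightarrow> i \<in> {1..m} \<Longrightarrow> 1 \<le> n \<Longrightarrow> in_ideal P R n g \<Longrightarrow>
    in_ideal P R (m + n - 1) (pcomp P m n i f g)"

definition operad_ideal :: "('k, 'a) operad \<Rightarrow> (nat \<Rightarrow> 'a set) \<Rightarrow> nat \<Rightarrow> 'a set" where
  "operad_ideal P R n = {f. in_ideal P R n f}"

text \<open>As for quotient rings, an operation on cosets is the union of the cosets of all results.\<close>

definition quot_operad :: "('k, 'a) operad \<Rightarrow> (nat \<Rightarrow> 'a set) \<Rightarrow> ('k, 'a set) operad" where
  "quot_operad P I = \<lparr>
     cpt = (\<lambda>n. \<lparr>carrier = a_rcosets\<^bsub>cpt P n\<^esub> (I n), monoid.mult = undefined, one = undefined,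
       zero = I n, add = set_add (cpt P n),
       module.smult = (\<lambda>c A. \<Union>f\<in>A. I n +>\<^bsub>cpt P n\<^esub> (c \<odot>\<^bsub>cpt P n\<^esub> f))\<rparr>),
     act = (\<lambda>n \<sigma> A. \<Union>f\<in>A. I n +>\<^bsub>cpt P n\<^esub> act P n \<sigma> f),
     ident = I 1 +>\<^bsub>cpt P 1\<^esub> ident P,
     pcomp = (\<lambda>m n i A B. \<Union>f\<in>A. \<Union>g\<in>B. I (m + n - 1) +>\<^bsub>cpt P (m + n - 1)\<^esub> pcomp P m n i f g)\<rparr>"


section \<open>The free operad on one binary operation without symmetry\<close>

text \<open>
  The free operad generated by the regular \<open>S\<^sub>2\<close>-module in arity 2: its component of arity \<open>n\<close> has
  as basis the nonassociative words in which each of the variables \<open>x\<^sub>1, \<dots>, x\<^sub>n\<close> occurs exactly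
  once.
\<close>

datatype 'v word = Var 'v | Mul "'v word" "'v word" (infixl \<open>\<cdot>\<close> 75)

primrec vars :: "'v word \<Rightarrow> 'v list" where
  "vars (Var v) = [v]"
| "vars (s \<cdot> t) = vars s @ vars t"

definition multilinear_words :: "nat \<Rightarrow> nat word set" where
  "multilinear_words n = {t. distinct (vars t) \<and> set (vars t) = {1..n}}"

text \<open>\<open>graft n i s t\<close> composes \<open>s\<close> at its variable \<open>i\<close> with the word \<open>t\<close> of arity \<open>n\<close>.\<close>

primrec graft :: "nat \<Rightarrow> nat \<Rightarrow> nat word \<Rightarrow> nat word \<Rightarrow> nat word" where
  "graft n i (Var j) t = (if j = i then map_word (\<lambda>p. i + p - 1) t else Var (skip_block n i j))"
| "graft n i (s\<^sub>1 \<cdot> s\<^sub>2) t = graft n i s\<^sub>1 t \<cdot> graft n i s\<^sub>2 t"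

definition Mag :: "('k::field, nat word \<Rightarrow>\<^sub>0 'k) operad" where
  "Mag = \<lparr>
     cpt = (\<lambda>n. \<lparr>carrier = {f. Poly_Mapping.keys f \<subseteq> multilinear_words n},
       monoid.mult = undefined, one = undefined, zero = 0, add = (+), module.smult = (\<lambda>c. Poly_Mapping.map ((*) c))\<rparr>),
     act = (\<lambda>n \<sigma> f. \<Sum>s\<in>Poly_Mapping.keys f.
       Poly_Mapping.single (map_word \<sigma> s) (Poly_Mapping.lookup f s)),
     ident = Poly_Mapping.single (Var 1) 1,
     pcomp = (\<lambda>m n i f g. \<Sum>s\<in>Poly_Mapping.keys f. \<Sum>t\<in>Poly_Mapping.keys g.
       Poly_Mapping.single (graft n i s t) (Poly_Mapping.lookup f s * Poly_Mapping.lookup g t))\<rparr>"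

definition presented :: "(nat \<Rightarrow> (nat word \<Rightarrow>\<^sub>0 'k::field) set) \<Rightarrow> ('k, (nat word \<Rightarrow>\<^sub>0 'k) set) operad"
  where "presented R = quot_operad Mag (operad_ideal Mag R)"

definition presented_class ::
    "(nat \<Rightarrow> (nat word \<Rightarrow>\<^sub>0 'k::field) set) \<Rightarrow> nat \<Rightarrow> (nat word \<Rightarrow>\<^sub>0 'k) \<Rightarrow> (nat word \<Rightarrow>\<^sub>0 'k) set"
  where "presented_class R n f = operad_ideal Mag R n +>\<^bsub>cpt Mag n\<^esub> f"


section \<open>The operads Lie, Com and Lie-adm\<close>

abbreviation wd :: "nat word \<Rightarrow> nat word \<Rightarrow>\<^sub>0 'k::field" where
  "wd t \<equiv> Poly_Mapping.single t 1"

abbreviation "x\<^sub>1 \<equiv> Var (1::nat)"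
abbreviation "x\<^sub>2 \<equiv> Var (2::nat)"
abbreviation "x\<^sub>3 \<equiv> Var (3::nat)"

text \<open>
  The symmetry of the generator is imposed as a relation in arity 2: the sign and the trivial
  \<open>S\<^sub>2\<close>-modules are the quotients of the regular one by \<open>x\<^sub>1x\<^sub>2 + x\<^sub>2x\<^sub>1\<close> and \<open>x\<^sub>1x\<^sub>2 - x\<^sub>2x\<^sub>1\<close>.
\<close>

definition Lie_rels :: "nat \<Rightarrow> (nat word \<Rightarrow>\<^sub>0 'k::field) set" where
  "Lie_rels = (\<lambda>_. {})(
     2 := {wd (x\<^sub>1 \<cdot> x\<^sub>2) + wd (x\<^sub>2 \<cdot> x\<^sub>1)},
     3 := {wd ((x\<^sub>1 \<cdot> x\<^sub>2) \<cdot> x\<^sub>3) + wd ((x\<^sub>2 \<cdot> x\<^sub>3) \<cdot> x\<^sub>1) + wd ((x\<^sub>3 \<cdot> x\<^sub>1) \<cdot> x\<^sub>2)})"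

definition Com_rels :: "nat \<Rightarrow> (nat word \<Rightarrow>\<^sub>0 'k::field) set" where
  "Com_rels = (\<lambda>_. {})(2 := {wd (x\<^sub>1 \<cdot> x\<^sub>2) - wd (x\<^sub>2 \<cdot> x\<^sub>1)})"

definition Lie_adm_rels :: "nat \<Rightarrow> (nat word \<Rightarrow>\<^sub>0 'k::field) set" where
  "Lie_adm_rels = (\<lambda>_. {})(
     3 := {wd ((x\<^sub>1 \<cdot> x\<^sub>2) \<cdot> x\<^sub>3)
       - (wd ((x\<^sub>2 \<cdot> x\<^sub>1) \<cdot> x\<^sub>3) + wd (x\<^sub>3 \<cdot> (x\<^sub>1 \<cdot> x\<^sub>2)) - wd (x\<^sub>3 \<cdot> (x\<^sub>2 \<cdot> x\<^sub>1))
          - wd ((x\<^sub>2 \<cdot> x\<^sub>3) \<cdot> x\<^sub>1) + wd ((x\<^sub>3 \<cdot> x\<^sub>2) \<cdot> x\<^sub>1)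
          + wd (x\<^sub>1 \<cdot> (x\<^sub>2 \<cdot> x\<^sub>3)) - wd (x\<^sub>1 \<cdot> (x\<^sub>3 \<cdot> x\<^sub>2))
          - wd ((x\<^sub>3 \<cdot> x\<^sub>1) \<cdot> x\<^sub>2) + wd ((x\<^sub>1 \<cdot> x\<^sub>3) \<cdot> x\<^sub>2)
          + wd (x\<^sub>2 \<cdot> (x\<^sub>3 \<cdot> x\<^sub>1)) - wd (x\<^sub>2 \<cdot> (x\<^sub>1 \<cdot> x\<^sub>3)))})"

definition Lie :: "('k::field, (nat word \<Rightarrow>\<^sub>0 'k) set) operad" where
  "Lie = presented Lie_rels"

definition Com :: "('k::field, (nat word \<Rightarrow>\<^sub>0 'k) set) operad" where
  "Com = presented Com_rels"

definition Lie_adm :: "('k::field, (nat word \<Rightarrow>\<^sub>0 'k) set) operad" where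
  "Lie_adm = presented Lie_adm_rels"

end

theory Submission
  imports Defs
begin

text \<open>
  Where 2 is invertible, a bilinear product \<open>ab\<close> is the same thing as a pair of a skew-symmetric
  product \<open>[a, b] = ab - ba\<close> and a symmetric product \<open>a \<circ> b = ab + ba\<close>: the original product is
  recovered as \<open>([a, b] + a \<circ> b) / 2\<close>.  The Lie-admissible identity is the Jacobi identity for
  \<open>[a, b]\<close> with all commutators expanded (\<open>commutator_hom_jacobi\<close>), and it puts no condition on
  \<open>a \<circ> b\<close>.  So a Lie-admissible structure is an arbitrary pair of a Lie structure and a commutative
  structure, which is the universal property of the free product (\<open>Lie_adm_is_free_product\<close>).

  For operads this argument needs to know what a morphism out of an operad given by one binary
  generator and relations is.  The operad \<open>Mag\<close> of nonassociative words is free on \<open>x\<^sub>1 x\<^sub>2\<close>: an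
  element \<open>a\<close> of arity 2 in an operad \<open>P\<close> is the image of \<open>x\<^sub>1 x\<^sub>2\<close> under a morphism (\<open>Mag_hom\<close>), and
  under only one (\<open>Mag_hom_unique\<close>).  This morphism evaluates a word by composing copies of \<open>a\<close> along its
  bracketing, with inputs numbered from left to right, and then letting the permutation of its
  variables act.  That this respects composition rests on the two associativity axioms for the
  bracketing (\<open>planar_eval_graft\<close>) and on equivariance for the permutations (\<open>leaf_perm_graft\<close>).

  Morphisms out of a quotient by an operadic ideal are the morphisms that kill its generators
  (\<open>presented_hom\<close>, \<open>presented_hom_unique\<close>).  Hence a morphism from Lie is an element \<open>l\<close> of arity 2
  that is skew and satisfies the Jacobi identity, one from Com is a symmetric element \<open>c\<close>, and
  \<open>(l + c) / 2\<close> is the corresponding Lie-admissible element (\<open>Mag_hom_half_sum\<close>).  Any other free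
  product is isomorphic to this one by the usual argument (\<open>free_product_unique\<close>).
\<close>

section \<open>Linear maps and morphisms of operads\<close>

abbreviation vector_space_on :: "('k::field, 'a) module \<Rightarrow> bool" where
  "vector_space_on M \<equiv> module (ring_of_type_algebra :: 'k ring) M"

text \<open>
  The module axioms with the operations of the ring \<open>ring_of_type_algebra\<close> replaced by those of
  the field, so that scalars can be computed with directly.
\<close>

lemma vector_space_onD:
  fixes M :: "('k::field, 'a) module"
  assumes "vector_space_on M"
  shows vs_abelian_group: "abelian_group M"
    and vs_smult_closed: "\<And>c x. x \<in> carrier M \<Longrightarrow> c \<odot>\<^bsub>M\<^esub> x \<in> carrier M"
    and vs_add_closed: "\<And>x y. x \<in> carrier M \<Longrightarrow> y \<in> carrier M \<Longrightarrow> x \<oplus>\<^bsub>M\<^esub> y \<in> carrier M"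
    and vs_zero_closed: "\<zero>\<^bsub>M\<^esub> \<in> carrier M"
    and vs_smult_l_distr: "\<And>c d x. x \<in> carrier M \<Longrightarrow>
      (c + d) \<odot>\<^bsub>M\<^esub> x = c \<odot>\<^bsub>M\<^esub> x \<oplus>\<^bsub>M\<^esub> d \<odot>\<^bsub>M\<^esub> x"
    and vs_smult_r_distr: "\<And>c x y. x \<in> carrier M \<Longrightarrow> y \<in> carrier M \<Longrightarrow>
      c \<odot>\<^bsub>M\<^esub> (x \<oplus>\<^bsub>M\<^esub> y) = c \<odot>\<^bsub>M\<^esub> x \<oplus>\<^bsub>M\<^esub> c \<odot>\<^bsub>M\<^esub> y"
    and vs_smult_assoc: "\<And>c d x. x \<in> carrier M \<Longrightarrow> (c * d) \<odot>\<^bsub>M\<^esub> x = c \<odot>\<^bsub>M\<^esub> (d \<odot>\<^bsub>M\<^esub> x)"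
    and vs_smult_one: "\<And>x. x \<in> carrier M \<Longrightarrow> 1 \<odot>\<^bsub>M\<^esub> x = x"
    and vs_smult_zero: "\<And>x. x \<in> carrier M \<Longrightarrow> 0 \<odot>\<^bsub>M\<^esub> x = \<zero>\<^bsub>M\<^esub>"
    and vs_smult_zero_right: "\<And>c. c \<odot>\<^bsub>M\<^esub> \<zero>\<^bsub>M\<^esub> = \<zero>\<^bsub>M\<^esub>"
    and vs_smult_minus_one: "\<And>x. x \<in> carrier M \<Longrightarrow> (- 1) \<odot>\<^bsub>M\<^esub> x = \<ominus>\<^bsub>M\<^esub> x"
proof -
  interpret module "ring_of_type_algebra :: 'k ring" M by fact
  note K = ring_of_type_algebra_def
  show "abelian_group M" ..
  show closed: "c \<odot>\<^bsub>M\<^esub> x \<in> carrier M" if "x \<in> carrier M" for c x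
    using smult_closed[of c x] that by (simp add: K)
  show "x \<oplus>\<^bsub>M\<^esub> y \<in> carrier M" if "x \<in> carrier M" "y \<in> carrier M" for x y
    using that by simp
  show "\<zero>\<^bsub>M\<^esub> \<in> carrier M" by simp
  show distr: "(c + d) \<odot>\<^bsub>M\<^esub> x = c \<odot>\<^bsub>M\<^esub> x \<oplus>\<^bsub>M\<^esub> d \<odot>\<^bsub>M\<^esub> x" if "x \<in> carrier M" for c d x
    using smult_l_distr[of c d x] that by (simp add: K)
  show "c \<odot>\<^bsub>M\<^esub> (x \<oplus>\<^bsub>M\<^esub> y) = c \<odot>\<^bsub>M\<^esub> x \<oplus>\<^bsub>M\<^esub> c \<odot>\<^bsub>M\<^esub> y"
    if "x \<in> carrier M" "y \<in> carrier M" for c x y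
    using smult_r_distr[of c x y] that by (simp add: K)
  show "(c * d) \<odot>\<^bsub>M\<^esub> x = c \<odot>\<^bsub>M\<^esub> (d \<odot>\<^bsub>M\<^esub> x)" if "x \<in> carrier M" for c d x
    using smult_assoc1[of c d x] that by (simp add: K)
  show one: "1 \<odot>\<^bsub>M\<^esub> x = x" if "x \<in> carrier M" for x
    using smult_one[of x] that by (simp add: K)
  show zero: "0 \<odot>\<^bsub>M\<^esub> x = \<zero>\<^bsub>M\<^esub>" if "x \<in> carrier M" for x
    using smult_l_null[of x] that by (simp add: K)
  show "c \<odot>\<^bsub>M\<^esub> \<zero>\<^bsub>M\<^esub> = \<zero>\<^bsub>M\<^esub>" for c
    using smult_r_null[of c] by (simp add: K)
  show "(- 1) \<odot>\<^bsub>M\<^esub> x = \<ominus>\<^bsub>M\<^esub> x" if "x \<in> carrier M" for x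
  proof (rule M.minus_equality[symmetric])
    show "(- 1) \<odot>\<^bsub>M\<^esub> x \<oplus>\<^bsub>M\<^esub> x = \<zero>\<^bsub>M\<^esub>"
      using distr[of x "- 1" 1] one zero that by simp
  qed (use closed that in auto)
qed

lemma vector_space_onI:
  fixes M :: "('k::field, 'a) module"
  assumes "abelian_group M"
    and "\<And>c x. x \<in> carrier M \<Longrightarrow> c \<odot>\<^bsub>M\<^esub> x \<in> carrier M"
    and "\<And>c d x. x \<in> carrier M \<Longrightarrow> (c + d) \<odot>\<^bsub>M\<^esub> x = c \<odot>\<^bsub>M\<^esub> x \<oplus>\<^bsub>M\<^esub> d \<odot>\<^bsub>M\<^esub> x"
    and "\<And>c x y. x \<in> carrier M \<Longrightarrow> y \<in> carrier M \<Longrightarrow>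
      c \<odot>\<^bsub>M\<^esub> (x \<oplus>\<^bsub>M\<^esub> y) = c \<odot>\<^bsub>M\<^esub> x \<oplus>\<^bsub>M\<^esub> c \<odot>\<^bsub>M\<^esub> y"
    and "\<And>c d x. x \<in> carrier M \<Longrightarrow> (c * d) \<odot>\<^bsub>M\<^esub> x = c \<odot>\<^bsub>M\<^esub> (d \<odot>\<^bsub>M\<^esub> x)"
    and "\<And>x. x \<in> carrier M \<Longrightarrow> 1 \<odot>\<^bsub>M\<^esub> x = x"
  shows "vector_space_on M"
  by (rule moduleI) (use assms in \<open>auto simp: ring_of_type_algebra_def\<close>,
      metis cring_from_type_algebra ring_of_type_algebra_def)

lemma linear_mapI:
  assumes "\<And>x. x \<in> carrier M \<Longrightarrow> f x \<in> carrier N"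
    and "\<And>x y. x \<in> carrier M \<Longrightarrow> y \<in> carrier M \<Longrightarrow> f (x \<oplus>\<^bsub>M\<^esub> y) = f x \<oplus>\<^bsub>N\<^esub> f y"
    and "\<And>c x. x \<in> carrier M \<Longrightarrow> f (c \<odot>\<^bsub>M\<^esub> x) = c \<odot>\<^bsub>N\<^esub> f x"
  shows "linear_map M N f"
  using assms unfolding linear_map_def by blast

lemma linear_mapD:
  assumes "linear_map M N f"
  shows linear_map_closed: "x \<in> carrier M \<Longrightarrow> f x \<in> carrier N"
    and linear_map_add: "x \<in> carrier M \<Longrightarrow> y \<in> carrier M \<Longrightarrow> f (x \<oplus>\<^bsub>M\<^esub> y) = f x \<oplus>\<^bsub>N\<^esub> f y"
    and linear_map_smult: "x \<in> carrier M \<Longrightarrow> f (c \<odot>\<^bsub>M\<^esub> x) = c \<odot>\<^bsub>N\<^esub> f x"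
  using assms unfolding linear_map_def by auto

lemma linear_map_compose:
  assumes "linear_map M N f" "linear_map N L g"
  shows "linear_map M L (\<lambda>x. g (f x))"
  by (rule linear_mapI) (simp_all add: linear_mapD[OF assms(1)] linear_mapD[OF assms(2)])

lemma linear_map_ident: "linear_map M M (\<lambda>x. x)"
  by (simp add: linear_map_def)

lemma linear_map_zero:
  fixes M :: "('k::field, 'a) module" and N :: "('k, 'b) module"
  assumes "linear_map M N f" "vector_space_on M" "vector_space_on N"
  shows "f \<zero>\<^bsub>M\<^esub> = \<zero>\<^bsub>N\<^esub>"
proof -
  have "f \<zero>\<^bsub>M\<^esub> = f (0 \<odot>\<^bsub>M\<^esub> \<zero>\<^bsub>M\<^esub>)"
    using vs_smult_zero_right[OF assms(2)] by simp
  also have "\<dots> = 0 \<odot>\<^bsub>N\<^esub> f \<zero>\<^bsub>M\<^esub>"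
    using linear_map_smult[OF assms(1)] vs_zero_closed[OF assms(2)] by blast
  also have "\<dots> = \<zero>\<^bsub>N\<^esub>"
    using vs_smult_zero[OF assms(3)] linear_map_closed[OF assms(1)] vs_zero_closed[OF assms(2)] by blast
  finally show ?thesis .
qed

lemma operad_homI:
  assumes "\<And>n. 1 \<le> n \<Longrightarrow> linear_map (cpt P n) (cpt Q n) (\<phi> n)"
    and "\<And>n \<sigma> f. 1 \<le> n \<Longrightarrow> \<sigma> permutes {1..n} \<Longrightarrow> f \<in> elems P n \<Longrightarrow>
      \<phi> n (act P n \<sigma> f) = act Q n \<sigma> (\<phi> n f)"
    and "\<phi> 1 (ident P) = ident Q"
    and "\<And>m n i f g. 1 \<le> m \<Longrightarrow> 1 \<le> n \<Longrightarrow> i \<in> {1..m} \<Longrightarrow> f \<in> elems P m \<Longrightarrow> g \<in> elems P n \<Longrightarrow>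
      \<phi> (m + n - 1) (pcomp P m n i f g) = pcomp Q m n i (\<phi> m f) (\<phi> n g)"
  shows "operad_hom P Q \<phi>"
  using assms unfolding operad_hom_def by blast

lemma operad_homD:
  assumes "operad_hom P Q \<phi>"
  shows hom_linear: "1 \<le> n \<Longrightarrow> linear_map (cpt P n) (cpt Q n) (\<phi> n)"
    and hom_closed: "1 \<le> n \<Longrightarrow> f \<in> elems P n \<Longrightarrow> \<phi> n f \<in> elems Q n"
    and hom_add: "1 \<le> n \<Longrightarrow> f \<in> elems P n \<Longrightarrow> g \<in> elems P n \<Longrightarrow>
      \<phi> n (f \<oplus>\<^bsub>cpt P n\<^esub> g) = \<phi> n f \<oplus>\<^bsub>cpt Q n\<^esub> \<phi> n g"
    and hom_smult: "1 \<le> n \<Longrightarrow> f \<in> elems P n \<Longrightarrow> \<phi> n (c \<odot>\<^bsub>cpt P n\<^esub> f) = c \<odot>\<^bsub>cpt Q n\<^esub> \<phi> n f"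
    and hom_act: "1 \<le> n \<Longrightarrow> \<sigma> permutes {1..n} \<Longrightarrow> f \<in> elems P n \<Longrightarrow>
      \<phi> n (act P n \<sigma> f) = act Q n \<sigma> (\<phi> n f)"
    and hom_ident: "\<phi> 1 (ident P) = ident Q"
    and hom_pcomp: "1 \<le> n \<Longrightarrow> i \<in> {1..m} \<Longrightarrow> f \<in> elems P m \<Longrightarrow> g \<in> elems P n \<Longrightarrow>
      \<phi> (m + n - 1) (pcomp P m n i f g) = pcomp Q m n i (\<phi> m f) (\<phi> n g)"
proof -
  show lin: "linear_map (cpt P n) (cpt Q n) (\<phi> n)" if "1 \<le> n" for n
    using assms that unfolding operad_hom_def by blast
  show "1 \<le> n \<Longrightarrow> f \<in> elems P n \<Longrightarrow> \<phi> n f \<in> elems Q n"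
    "1 \<le> n \<Longrightarrow> f \<in> elems P n \<Longrightarrow> g \<in> elems P n \<Longrightarrow>
      \<phi> n (f \<oplus>\<^bsub>cpt P n\<^esub> g) = \<phi> n f \<oplus>\<^bsub>cpt Q n\<^esub> \<phi> n g"
    "1 \<le> n \<Longrightarrow> f \<in> elems P n \<Longrightarrow> \<phi> n (c \<odot>\<^bsub>cpt P n\<^esub> f) = c \<odot>\<^bsub>cpt Q n\<^esub> \<phi> n f"
    using linear_mapD[OF lin] by blast+
  show "1 \<le> n \<Longrightarrow> \<sigma> permutes {1..n} \<Longrightarrow> f \<in> elems P n \<Longrightarrow>
      \<phi> n (act P n \<sigma> f) = act Q n \<sigma> (\<phi> n f)" "\<phi> 1 (ident P) = ident Q"
    using assms unfolding operad_hom_def by blast+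
  show "\<phi> (m + n - 1) (pcomp P m n i f g) = pcomp Q m n i (\<phi> m f) (\<phi> n g)"
    if "1 \<le> n" "i \<in> {1..m}" "f \<in> elems P m" "g \<in> elems P n"
  proof -
    have "1 \<le> m" using that(2) by simp
    then show ?thesis
      using assms that unfolding operad_hom_def by blast
  qed
qed

context operad
begin

lemma act_closed: "1 \<le> n \<Longrightarrow> \<sigma> permutes {1..n} \<Longrightarrow> f \<in> elems P n \<Longrightarrow> act P n \<sigma> f \<in> elems P n"
  using linear_map_closed[OF act_linear] by blast

lemma pcomp_closed:
  "i \<in> {1..m} \<Longrightarrow> 1 \<le> n \<Longrightarrow> f \<in> elems P m \<Longrightarrow> g \<in> elems P n \<Longrightarrow>
    pcomp P m n i f g \<in> elems P (m + n - 1)"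
  using linear_map_closed[OF pcomp_linear_left] by blast

end

lemma operad_hom_id: "operad_hom P P (\<lambda>n f. f)"
  by (rule operad_homI) (auto intro: linear_mapI)

lemma operad_hom_compose:
  assumes "operad_hom P Q \<phi>" "operad_hom Q R \<psi>"
  shows "operad_hom P R (\<lambda>n f. \<psi> n (\<phi> n f))"
proof (rule operad_homI)
  show "linear_map (cpt P n) (cpt R n) (\<lambda>f. \<psi> n (\<phi> n f))" if "1 \<le> n" for n
    using linear_map_compose hom_linear[OF assms(1) that] hom_linear[OF assms(2) that] by blast
qed (simp_all add: operad_homD[OF assms(1)] operad_homD[OF assms(2)] del: One_nat_def atLeastAtMost_iff)

lemma hom_eqD: "hom_eq P \<phi> \<psi> \<Longrightarrow> 1 \<le> n \<Longrightarrow> f \<in> elems P n \<Longrightarrow> \<phi> n f = \<psi> n f"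
  by (simp add: hom_eq_def)

text \<open>
  The two mediating morphisms are mutually inverse because both composites agree with the identity
  on the images of the two factors.  The universal property of each operad is applied twice: to the
  other operad, which gives a morphism, and to the operad itself, where uniqueness identifies the
  composite with the identity.
\<close>

lemma free_product_unique:
  assumes F: "is_free_product TYPE('c) O\<^sub>1 O\<^sub>2 (F :: ('k::field, 'c) operad) \<pi>\<^sub>1 \<pi>\<^sub>2"
      "is_free_product TYPE('d) O\<^sub>1 O\<^sub>2 F \<pi>\<^sub>1 \<pi>\<^sub>2"
    and G: "is_free_product TYPE('d) O\<^sub>1 O\<^sub>2 (G :: ('k, 'd) operad) \<rho>\<^sub>1 \<rho>\<^sub>2"
      "is_free_product TYPE('c) O\<^sub>1 O\<^sub>2 G \<rho>\<^sub>1 \<rho>\<^sub>2"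
  shows "operad_isomorphic F G"
proof -
  have homs: "operad F" "operad_hom O\<^sub>1 F \<pi>\<^sub>1" "operad_hom O\<^sub>2 F \<pi>\<^sub>2"
    "operad G" "operad_hom O\<^sub>1 G \<rho>\<^sub>1" "operad_hom O\<^sub>2 G \<rho>\<^sub>2"
    using F(1) G(1) unfolding is_free_product_def by blast+
  obtain \<phi> where \<phi>: "operad_hom F G \<phi>" "hom_eq O\<^sub>1 \<rho>\<^sub>1 (\<lambda>n f. \<phi> n (\<pi>\<^sub>1 n f))"
    "hom_eq O\<^sub>2 \<rho>\<^sub>2 (\<lambda>n f. \<phi> n (\<pi>\<^sub>2 n f))"
    using F(2) homs unfolding is_free_product_def by blast
  obtain \<theta> where \<theta>: "operad_hom G F \<theta>" "hom_eq O\<^sub>1 \<pi>\<^sub>1 (\<lambda>n f. \<theta> n (\<rho>\<^sub>1 n f))"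
    "hom_eq O\<^sub>2 \<pi>\<^sub>2 (\<lambda>n f. \<theta> n (\<rho>\<^sub>2 n f))"
    using G(2) homs unfolding is_free_product_def by blast
  \<comment> \<open>Both composites restrict to the given morphisms, as the identities do.\<close>
  have "\<exists>\<psi>. \<forall>\<psi>'. operad_hom F F \<psi>' \<and> hom_eq O\<^sub>1 \<pi>\<^sub>1 (\<lambda>n f. \<psi>' n (\<pi>\<^sub>1 n f)) \<and>
      hom_eq O\<^sub>2 \<pi>\<^sub>2 (\<lambda>n f. \<psi>' n (\<pi>\<^sub>2 n f)) \<longrightarrow> hom_eq F \<psi>' \<psi>"
    using F(1) homs unfolding is_free_product_def by blast
  then obtain \<psi> where \<psi>: "\<And>\<psi>'. operad_hom F F \<psi>' \<Longrightarrow> hom_eq O\<^sub>1 \<pi>\<^sub>1 (\<lambda>n f. \<psi>' n (\<pi>\<^sub>1 n f)) \<Longrightarrow>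
      hom_eq O\<^sub>2 \<pi>\<^sub>2 (\<lambda>n f. \<psi>' n (\<pi>\<^sub>2 n f)) \<Longrightarrow> hom_eq F \<psi>' \<psi>"
    by blast
  have "hom_eq F (\<lambda>n f. \<theta> n (\<phi> n f)) \<psi>"
    by (rule \<psi>) (use operad_hom_compose[OF \<phi>(1) \<theta>(1)] \<phi>(2,3) \<theta>(2,3) in \<open>auto simp: hom_eq_def\<close>)
  moreover have "hom_eq F (\<lambda>n f. f) \<psi>"
    by (rule \<psi>) (auto simp: hom_eq_def operad_hom_id)
  ultimately have \<theta>\<phi>: "\<theta> n (\<phi> n f) = f" if "1 \<le> n" "f \<in> elems F n" for n f
    using that by (simp add: hom_eq_def)
  have "\<exists>\<chi>. \<forall>\<psi>'. operad_hom G G \<psi>' \<and> hom_eq O\<^sub>1 \<rho>\<^sub>1 (\<lambda>n f. \<psi>' n (\<rho>\<^sub>1 n f)) \<and>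
      hom_eq O\<^sub>2 \<rho>\<^sub>2 (\<lambda>n f. \<psi>' n (\<rho>\<^sub>2 n f)) \<longrightarrow> hom_eq G \<psi>' \<chi>"
    using G(1) homs unfolding is_free_product_def by blast
  then obtain \<chi> where \<chi>: "\<And>\<psi>'. operad_hom G G \<psi>' \<Longrightarrow> hom_eq O\<^sub>1 \<rho>\<^sub>1 (\<lambda>n f. \<psi>' n (\<rho>\<^sub>1 n f)) \<Longrightarrow>
      hom_eq O\<^sub>2 \<rho>\<^sub>2 (\<lambda>n f. \<psi>' n (\<rho>\<^sub>2 n f)) \<Longrightarrow> hom_eq G \<psi>' \<chi>"
    by blast
  have "hom_eq G (\<lambda>n f. \<phi> n (\<theta> n f)) \<chi>"
    by (rule \<chi>) (use operad_hom_compose[OF \<theta>(1) \<phi>(1)] \<phi>(2,3) \<theta>(2,3) in \<open>auto simp: hom_eq_def\<close>)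
  moreover have "hom_eq G (\<lambda>n f. f) \<chi>"
    by (rule \<chi>) (auto simp: hom_eq_def operad_hom_id)
  ultimately have \<phi>\<theta>: "\<phi> n (\<theta> n f) = f" if "1 \<le> n" "f \<in> elems G n" for n f
    using that by (simp add: hom_eq_def)
  have "bij_betw (\<phi> n) (elems F n) (elems G n)" if "1 \<le> n" for n
    by (rule bij_betw_byWitness[where f' = "\<theta> n"])
      (use that \<phi>\<theta> \<theta>\<phi> hom_closed[OF \<phi>(1)] hom_closed[OF \<theta>(1)] in auto)
  with \<phi>(1) show ?thesis
    unfolding operad_isomorphic_def by blast
qed


section \<open>The operad of nonassociative words\<close>

lemma Mag_simps [simp]:
  "f \<in> elems Mag n \<longleftrightarrow> Poly_Mapping.keys f \<subseteq> multilinear_words n"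
  "\<zero>\<^bsub>cpt Mag n\<^esub> = 0"
  "f \<oplus>\<^bsub>cpt Mag n\<^esub> g = f + g"
  "c \<odot>\<^bsub>cpt Mag n\<^esub> f = Poly_Mapping.map ((*) c) f"
  "ident Mag = wd x\<^sub>1"
  by (simp_all add: Mag_def)

lemma lookup_scale [simp]:
  "Poly_Mapping.lookup (Poly_Mapping.map ((*) (c::'k::field)) f) t = c * Poly_Mapping.lookup f t"
  by (auto simp: Poly_Mapping.map.rep_eq when_def)

lemma keys_scale: "Poly_Mapping.keys (Poly_Mapping.map ((*) (c::'k::field)) f) \<subseteq> Poly_Mapping.keys f"
  by (auto simp: in_keys_iff)

lemma scale_add:
  "Poly_Mapping.map ((*) (c::'k::field)) (f + g) = Poly_Mapping.map ((*) c) f + Poly_Mapping.map ((*) c) g"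
  by (rule poly_mapping_eqI) (simp add: lookup_add algebra_simps)

lemma scale_sum:
  "Poly_Mapping.map ((*) (c::'k::field)) (\<Sum>t\<in>A. f t) = (\<Sum>t\<in>A. Poly_Mapping.map ((*) c) (f t))"
proof (induction A rule: infinite_finite_induct)
  case (insert t A)
  then show ?case by (simp add: scale_add)
qed (simp_all add: poly_mapping_eqI)

text \<open>
  Scaling by 0 empties the support, but the summands lost are zero.
\<close>

lemma keys_sum_scale:
  fixes h :: "'a \<Rightarrow> 'k::field \<Rightarrow> 'b::comm_monoid_add"
  assumes "\<And>t. h t 0 = 0"
  shows "(\<Sum>t\<in>Poly_Mapping.keys (Poly_Mapping.map ((*) c) f). h t (c * Poly_Mapping.lookup f t)) =
    (\<Sum>t\<in>Poly_Mapping.keys f. h t (c * Poly_Mapping.lookup f t))"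
  by (rule sum.mono_neutral_left) (use assms keys_scale in \<open>auto simp: in_keys_iff\<close>)

lemma vector_space_on_Mag: "vector_space_on (cpt Mag n :: ('k::field, nat word \<Rightarrow>\<^sub>0 'k) module)"
proof (rule vector_space_onI)
  show "abelian_group (cpt Mag n :: ('k, nat word \<Rightarrow>\<^sub>0 'k) module)"
  proof (rule abelian_groupI)
    show "\<exists>g\<in>elems Mag n. g \<oplus>\<^bsub>cpt Mag n\<^esub> f = \<zero>\<^bsub>cpt Mag n\<^esub>" if "f \<in> elems Mag n"
      for f :: "nat word \<Rightarrow>\<^sub>0 'k"
      using that by (intro bexI[of _ "- f"]) auto
  qed (auto simp: algebra_simps dest: subsetD[OF Poly_Mapping.keys_add])
qed (use keys_scale in \<open>fastforce simp: scale_add algebra_simps lookup_add intro!: poly_mapping_eqI\<close>)+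

text \<open>
  Words span \<open>Mag\<close>, so a linear map out of a component is determined by its values on them.
  This reduces every identity between multilinear operations to one about words.
\<close>

lemma linear_map_Mag_eqI:
  fixes N :: "('k::field, 'a) module"
  assumes N: "vector_space_on N"
    and f: "linear_map (cpt Mag n) N f" and g: "linear_map (cpt Mag n) N g"
    and words: "\<And>t. t \<in> multilinear_words n \<Longrightarrow> f (wd t) = g (wd t)"
    and x: "x \<in> elems Mag n"
  shows "f x = g x"
proof -
  have "f x = g x" if "finite A" "Poly_Mapping.keys x \<subseteq> A" "A \<subseteq> multilinear_words n" for A
    using that
  proof (induction A arbitrary: x)
    case empty
    then have "x = \<zero>\<^bsub>cpt Mag n\<^esub>" by simp
    then show ?case
      using linear_map_zero[OF f vector_space_on_Mag N] linear_map_zero[OF g vector_space_on_Mag N]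
      by metis
  next
    case (insert t A)
    define y where "y = x - Poly_Mapping.single t (Poly_Mapping.lookup x t)"
    have y: "Poly_Mapping.keys y \<subseteq> A"
      using insert.prems by (auto simp: y_def in_keys_iff lookup_minus lookup_single when_def split: if_splits)
    have t: "t \<in> multilinear_words n" using insert.prems by simp
    let ?s = "Poly_Mapping.lookup x t \<odot>\<^bsub>cpt Mag n\<^esub> wd t"
    have x: "x = y \<oplus>\<^bsub>cpt Mag n\<^esub> ?s" by (simp add: y_def)
    have closed: "y \<in> elems Mag n" "wd t \<in> elems Mag n" "?s \<in> elems Mag n"
      using y insert.prems t by auto
    have "f y = g y" using insert.IH[OF y] insert.prems by simp
    then show ?case
      by (subst (1 2) x)
        (simp only: linear_map_add[OF f closed(1,3)] linear_map_add[OF g closed(1,3)]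
          linear_map_smult[OF f closed(2)] linear_map_smult[OF g closed(2)] words[OF t])
  qed
  then show ?thesis using x by (metis Mag_simps(1) finite_keys order_refl)
qed

lemma vars_map_word [simp]: "vars (map_word h t) = map h (vars t)"
  by (induction t) auto

lemma vars_nonempty [simp]: "vars t \<noteq> []"
  by (induction t) auto

lemma length_vars_multilinear: "t \<in> multilinear_words n \<Longrightarrow> length (vars t) = n"
  unfolding multilinear_words_def by (metis (mono_tags, lifting) card_atLeastAtMost diff_Suc_1 distinct_card mem_Collect_eq)

lemma multilinear_split:
  assumes "s \<in> multilinear_words m" "i \<in> {1..m}"
  obtains xs ys where "vars s = xs @ i # ys" "i \<notin> set xs" "i \<notin> set ys"
proof -
  have "i \<in> set (vars s)" "distinct (vars s)"
    using assms unfolding multilinear_words_def by auto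
  then show ?thesis using split_list[of i "vars s"] that by fastforce
qed

lemma map_word_multilinear:
  assumes "\<sigma> permutes {1..n}" "t \<in> multilinear_words n"
  shows "map_word \<sigma> t \<in> multilinear_words n"
  using assms permutes_image[OF assms(1)] inj_on_subset[OF permutes_inj[OF assms(1)]]
  unfolding multilinear_words_def by (auto simp: distinct_map)

lemma map_word_cong_vars: "(\<And>v. v \<in> set (vars t) \<Longrightarrow> h v = h' v) \<Longrightarrow> map_word h t = map_word h' t"
  by (induction t) auto

lemma graft_eq_map_word: "i \<notin> set (vars s) \<Longrightarrow> graft n i s t = map_word (skip_block n i) s"
  by (induction s) auto

text \<open>
  For a word in which \<open>i\<close> occurs once, the variables of a graft are those of the outer word,
  renumbered, with the block of variables of the inner word in place of \<open>i\<close>.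
\<close>

lemma vars_graft:
  assumes "vars s = xs @ i # ys" "i \<notin> set xs" "i \<notin> set ys"
  shows "vars (graft n i s t) =
    map (skip_block n i) xs @ map (\<lambda>p. i + p - 1) (vars t) @ map (skip_block n i) ys"
proof -
  have "vars (graft n i s t) = concat (map (\<lambda>j. if j = i then map (\<lambda>p. i + p - 1) (vars t)
      else [skip_block n i j]) (vars s))"
    by (induction s) auto
  moreover have "concat (map (\<lambda>j. if j = i then map (\<lambda>p. i + p - 1) (vars t)
      else [skip_block n i j]) zs) = map (skip_block n i) zs" if "i \<notin> set zs" for zs
    using that by (induction zs) auto
  ultimately show ?thesis using assms by simp
qed

text \<open>
  A graft has \<open>m + n - 1\<close> leaves; since every variable in \<open>{1..m + n - 1}\<close> occurs, none occurs twice.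
\<close>

lemma graft_multilinear:
  assumes i: "i \<in> {1..m}" and n: "1 \<le> n"
    and s: "s \<in> multilinear_words m" and t: "t \<in> multilinear_words n"
  shows "graft n i s t \<in> multilinear_words (m + n - 1)"
proof -
  obtain xs ys where xy: "vars s = xs @ i # ys" and ni: "i \<notin> set xs" "i \<notin> set ys"
    using multilinear_split[OF s i] .
  have sets: "set xs \<union> set ys = {1..m} - {i}"
    using s xy unfolding multilinear_words_def by auto
  have v: "set (vars (graft n i s t)) =
      skip_block n i ` ({1..m} - {i}) \<union> (\<lambda>p. i + p - 1) ` {1..n}"
    using t unfolding vars_graft[OF xy ni] sets[symmetric] by (auto simp: multilinear_words_def)
  also have "\<dots> = {1..m + n - 1}"
  proof (intro equalityI subsetI)
    fix q assume q: "q \<in> {1..m + n - 1}"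
    consider "q < i" | "i \<le> q" "q < i + n" | "i + n \<le> q" by linarith
    then show "q \<in> skip_block n i ` ({1..m} - {i}) \<union> (\<lambda>p. i + p - 1) ` {1..n}"
    proof cases
      case 1
      then have "q = skip_block n i q" "q \<in> {1..m} - {i}" using q i by (auto simp: skip_block_def)
      then show ?thesis by blast
    next
      case 2
      then have "q = i + (q - i + 1) - 1" "q - i + 1 \<in> {1..n}" by auto
      then show ?thesis by blast
    next
      case 3
      then have "q = skip_block n i (q - n + 1)" "q - n + 1 \<in> {1..m} - {i}"
        using q i by (auto simp: skip_block_def)
      then show ?thesis by blast
    qed
  qed (use i n in \<open>auto simp: skip_block_def split: if_splits\<close>)
  finally have "set (vars (graft n i s t)) = {1..m + n - 1}" .
  moreover have "length (vars (graft n i s t)) = m + n - 1"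
    using length_vars_multilinear[OF s] length_vars_multilinear[OF t]
    by (simp add: vars_graft[OF xy ni] xy)
  ultimately show ?thesis
    unfolding multilinear_words_def by (simp add: card_distinct)
qed

lemma Mag_act_wd: "act Mag n \<sigma> (wd t :: nat word \<Rightarrow>\<^sub>0 'k::field) = wd (map_word \<sigma> t)"
  by (simp add: Mag_def)

lemma Mag_pcomp_wd:
  "pcomp Mag m n i (wd s) (wd t :: nat word \<Rightarrow>\<^sub>0 'k::field) = wd (graft n i s t)"
  by (simp add: Mag_def)

lemma Mag_act_linear:
  assumes "\<sigma> permutes {1..n}"
  shows "linear_map (cpt Mag n) (cpt Mag n) (act Mag n \<sigma> :: (nat word \<Rightarrow>\<^sub>0 'k::field) \<Rightarrow> _)"
proof (rule linear_mapI)
  fix f g :: "nat word \<Rightarrow>\<^sub>0 'k" and c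
  show "f \<in> elems Mag n \<Longrightarrow> act Mag n \<sigma> f \<in> elems Mag n"
    using map_word_multilinear[OF assms] by (fastforce simp: Mag_def dest!: subsetD[OF keys_sum] split: if_splits)
  show "act Mag n \<sigma> (f \<oplus>\<^bsub>cpt Mag n\<^esub> g) = act Mag n \<sigma> f \<oplus>\<^bsub>cpt Mag n\<^esub> act Mag n \<sigma> g"
    unfolding Mag_simps unfolding Mag_def operad.simps
    by (rule setsum_keys_plus_distrib) (simp_all add: single_add)
  show "act Mag n \<sigma> (c \<odot>\<^bsub>cpt Mag n\<^esub> f) = c \<odot>\<^bsub>cpt Mag n\<^esub> act Mag n \<sigma> f"
    by (simp add: Mag_def scale_sum keys_sum_scale[where h = "\<lambda>t. Poly_Mapping.single (map_word \<sigma> t)"])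
qed

lemma Mag_pcomp_closed:
  assumes "i \<in> {1..m}" "1 \<le> n" "f \<in> elems Mag m" "g \<in> elems Mag n"
  shows "pcomp Mag m n i f (g :: nat word \<Rightarrow>\<^sub>0 'k::field) \<in> elems Mag (m + n - 1)"
proof -
  have "Poly_Mapping.keys (pcomp Mag m n i f g) \<subseteq> (\<Union>s\<in>Poly_Mapping.keys f. \<Union>t\<in>Poly_Mapping.keys g.
      Poly_Mapping.keys (Poly_Mapping.single (graft n i s t) (Poly_Mapping.lookup f s * Poly_Mapping.lookup g t)))"
    unfolding Mag_def operad.simps by (intro order_trans[OF keys_sum] UN_mono order_refl)
  also have "\<dots> \<subseteq> multilinear_words (m + n - 1)"
    using graft_multilinear[OF assms(1,2)] assms(3,4) by (fastforce split: if_splits)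
  finally show ?thesis by simp
qed

lemma Mag_pcomp_linear_left:
  assumes "i \<in> {1..m}" "1 \<le> n" "g \<in> elems Mag n"
  shows "linear_map (cpt Mag m) (cpt Mag (m + n - 1))
    (\<lambda>f. pcomp Mag m n i f (g :: nat word \<Rightarrow>\<^sub>0 'k::field))"
proof (rule linear_mapI)
  fix f f' :: "nat word \<Rightarrow>\<^sub>0 'k" and c
  show "f \<in> elems Mag m \<Longrightarrow> pcomp Mag m n i f g \<in> elems Mag (m + n - 1)"
    by (rule Mag_pcomp_closed[OF assms(1,2) _ assms(3)])
  let ?h = "\<lambda>s x. \<Sum>t\<in>Poly_Mapping.keys g. Poly_Mapping.single (graft n i s t) (x * Poly_Mapping.lookup g t)"
  have pcomp: "pcomp Mag m n i f g = (\<Sum>s\<in>Poly_Mapping.keys f. ?h s (Poly_Mapping.lookup f s))" for f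
    by (simp add: Mag_def)
  show "pcomp Mag m n i (f \<oplus>\<^bsub>cpt Mag m\<^esub> f') g =
      pcomp Mag m n i f g \<oplus>\<^bsub>cpt Mag (m + n - 1)\<^esub> pcomp Mag m n i f' g"
    unfolding pcomp Mag_simps
    by (rule setsum_keys_plus_distrib) (simp_all add: sum.distrib single_add distrib_right)
  show "pcomp Mag m n i (c \<odot>\<^bsub>cpt Mag m\<^esub> f) g = c \<odot>\<^bsub>cpt Mag (m + n - 1)\<^esub> pcomp Mag m n i f g"
    unfolding pcomp Mag_simps lookup_scale
    by (subst keys_sum_scale[where h = ?h]) (simp_all add: scale_sum mult.assoc)
qed

lemma Mag_pcomp_linear_right:
  assumes "i \<in> {1..m}" "1 \<le> n" "f \<in> elems Mag m"
  shows "linear_map (cpt Mag n) (cpt Mag (m + n - 1))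
    (\<lambda>g. pcomp Mag m n i f (g :: nat word \<Rightarrow>\<^sub>0 'k::field))"
proof (rule linear_mapI)
  fix g g' :: "nat word \<Rightarrow>\<^sub>0 'k" and c
  show "g \<in> elems Mag n \<Longrightarrow> pcomp Mag m n i f g \<in> elems Mag (m + n - 1)"
    by (rule Mag_pcomp_closed[OF assms])
  let ?h = "\<lambda>t x. \<Sum>s\<in>Poly_Mapping.keys f. Poly_Mapping.single (graft n i s t) (Poly_Mapping.lookup f s * x)"
  have pcomp: "pcomp Mag m n i f g = (\<Sum>t\<in>Poly_Mapping.keys g. ?h t (Poly_Mapping.lookup g t))" for g
    unfolding Mag_def operad.simps by (rule sum.swap)
  show "pcomp Mag m n i f (g \<oplus>\<^bsub>cpt Mag n\<^esub> g') =
      pcomp Mag m n i f g \<oplus>\<^bsub>cpt Mag (m + n - 1)\<^esub> pcomp Mag m n i f g'"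
    unfolding pcomp Mag_simps
    by (rule setsum_keys_plus_distrib) (simp_all add: sum.distrib single_add distrib_left)
  show "pcomp Mag m n i f (c \<odot>\<^bsub>cpt Mag n\<^esub> g) = c \<odot>\<^bsub>cpt Mag (m + n - 1)\<^esub> pcomp Mag m n i f g"
    unfolding pcomp Mag_simps lookup_scale
    by (subst keys_sum_scale[where h = ?h]) (simp_all add: scale_sum mult.left_commute)
qed

lemma graft_Var_left: "graft n 1 x\<^sub>1 t = t"
  by (simp add: word.map_ident)

lemma graft_Var_right: "graft 1 i s x\<^sub>1 = s"
  by (induction s) (auto simp: skip_block_def)

lemma multilinear_ge_one: "t \<in> multilinear_words n \<Longrightarrow> 0 \<notin> set (vars t)"
  by (auto simp: multilinear_words_def)

text \<open>
  Variables are numbered from 1, and the shift \<open>p \<mapsto> i + p - 1\<close> of the inner word is injective only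
  on positive numbers.
\<close>

lemma graft_sequential:
  assumes j: "j \<in> {1..m}" and t: "0 \<notin> set (vars t)" and n: "1 \<le> n"
  shows "graft n (i + j - 1) (graft m i s t) u = graft (m + n - 1) i s (graft n j t u)"
proof (induction s)
  case (Var v)
  have "graft n (i + j - 1) (map_word (\<lambda>p. i + p - 1) t) u = map_word (\<lambda>p. i + p - 1) (graft n j t u)"
    using t j by (induction t) (auto simp: word.map_comp skip_block_def intro!: map_word_cong_vars)
  then show ?case using j n by (auto simp: skip_block_def)
qed auto

text \<open>
  The two blocks must not interfere: variables of \<open>t\<close> above \<open>m\<close> could be shifted onto \<open>j + m - 1\<close>,
  and a variable 0 of \<open>u\<close> onto \<open>i\<close>.
\<close>

lemma graft_parallel:
  assumes "i < j" "0 \<notin> set (vars u)" "set (vars t) \<subseteq> {1..m}" "1 \<le> m" "1 \<le> n"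
  shows "graft n (j + m - 1) (graft m i s t) u = graft m i (graft n j s u) t"
proof (induction s)
  case (Var v)
  have "i + p - 1 < j + m - 1" if "p \<in> set (vars t)" for p
    using assms(1,3) that by force
  then have "graft n (j + m - 1) (map_word (\<lambda>p. i + p - 1) t) u = map_word (\<lambda>p. i + p - 1) t"
    by (subst graft_eq_map_word)
      (force simp: word.map_comp skip_block_def intro!: map_word_cong_vars)+
  moreover have "i < j + p - 1" if "p \<in> set (vars u)" for p
    using assms(1,2) that by (cases p) auto
  then have "graft m i (map_word (\<lambda>p. j + p - 1) u) t = map_word (\<lambda>p. j + m - 1 + p - 1) u"
    using assms(1,4) by (subst graft_eq_map_word)
      (force simp: word.map_comp skip_block_def intro!: map_word_cong_vars)+
  ultimately show ?case using assms by (auto simp: skip_block_def)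
qed auto

lemma graft_equivariant:
  assumes "inj \<sigma>" "set (vars t) \<subseteq> {1..n}"
  shows "graft n (\<sigma> i) (map_word \<sigma> s) (map_word \<tau> t) = map_word (block_perm n i \<sigma> \<tau>) (graft n i s t)"
proof (induction s)
  case (Var v)
  show ?case
  proof (cases "v = i")
    case True
    have "map_word (\<lambda>p. \<sigma> i + p - 1) (map_word \<tau> t) =
        map_word (block_perm n i \<sigma> \<tau>) (map_word (\<lambda>p. i + p - 1) t)"
      unfolding word.map_comp using assms(2)
      by (intro map_word_cong_vars) (auto simp: block_perm_def subset_iff)
    then show ?thesis using True by simp
  next
    case False
    then have "\<sigma> v \<noteq> \<sigma> i" using assms(1) by (simp add: inj_eq)
    then show ?thesis using False by (auto simp: block_perm_def skip_block_def)
  qed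
qed auto

lemma multilinear_words_nonempty:
  assumes "1 \<le> n"
  obtains t where "t \<in> multilinear_words n"
proof -
  have "\<exists>t. t \<in> multilinear_words n"
    using assms
  proof (induction n rule: nat_induct_at_least)
    case base
    show ?case by (rule exI[of _ x\<^sub>1]) (auto simp: multilinear_words_def)
  next
    case (Suc n)
    then obtain t where "t \<in> multilinear_words n" by blast
    then have "t \<cdot> Var (Suc n) \<in> multilinear_words (Suc n)"
      by (auto simp: multilinear_words_def)
    then show ?case by blast
  qed
  then show ?thesis using that by blast
qed

text \<open>
  Permuting the variables of two multilinear words before grafting again gives a multilinear word.
  By \<open>graft_equivariant\<close> it is the image of the original graft under the block permutation, which
  therefore maps \<open>{1..m + n - 1}\<close> onto itself; on a finite set this makes it a bijection.
\<close>

lemma block_perm_permutes: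
  assumes i: "i \<in> {1..m}" and n: "1 \<le> n" and \<sigma>: "\<sigma> permutes {1..m}" and \<tau>: "\<tau> permutes {1..n}"
  shows "block_perm n i \<sigma> \<tau> permutes {1..m + n - 1}"
proof -
  let ?b = "block_perm n i \<sigma> \<tau>"
  have \<sigma>i: "\<sigma> i \<in> {1..m}" using permutes_in_image[OF \<sigma>] i by blast
  have m: "1 \<le> m" using i by simp
  obtain s t where s: "s \<in> multilinear_words m" and t: "t \<in> multilinear_words n"
    using multilinear_words_nonempty m n by metis
  have "graft n (\<sigma> i) (map_word \<sigma> s) (map_word \<tau> t) = map_word ?b (graft n i s t)"
    using t by (intro graft_equivariant[OF permutes_inj[OF \<sigma>]]) (simp add: multilinear_words_def)
  then have "map_word ?b (graft n i s t) \<in> multilinear_words (m + n - 1)"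
    using graft_multilinear[OF \<sigma>i n map_word_multilinear[OF \<sigma> s] map_word_multilinear[OF \<tau> t]] by simp
  then have surj: "?b ` {1..m + n - 1} = {1..m + n - 1}"
    using graft_multilinear[OF i n s t] by (simp add: multilinear_words_def)
  show ?thesis
  proof (rule bij_imp_permutes)
    show "bij_betw ?b {1..m + n - 1} {1..m + n - 1}"
      using surj finite_surj_inj[of "{1..m + n - 1}" ?b] by (simp add: bij_betw_def)
    fix p assume p: "p \<notin> {1..m + n - 1}"
    show "?b p = p"
    proof (cases "p = 0")
      case True
      then show ?thesis using i \<sigma>i permutes_not_in[OF \<sigma>, of 0]
        by (simp add: block_perm_def skip_block_def)
    next
      case False
      then have "p - n + 1 \<notin> {1..m}" "i + n \<le> p" using p i n by auto
      then show ?thesis using n \<sigma>i permutes_not_in[OF \<sigma>, of "p - n + 1"]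
        by (auto simp: block_perm_def skip_block_def)
    qed
  qed
qed

text \<open>
  All operations are linear in each argument, so every axiom follows, one argument at a time, from
  the corresponding identity for words.
\<close>

lemma operad_Mag: "operad (Mag :: ('k::field, nat word \<Rightarrow>\<^sub>0 'k) operad)"
proof -
  note eqI = linear_map_Mag_eqI[OF vector_space_on_Mag]
  have wd_closed: "wd t \<in> elems Mag n" if "t \<in> multilinear_words n" for t n
    using that by simp
  show ?thesis
  proof (rule operad.intro)
    fix n :: nat and f :: "nat word \<Rightarrow>\<^sub>0 'k" and \<sigma> \<tau>
    assume n: "1 \<le> n"
    show "vector_space_on (cpt Mag n :: ('k, nat word \<Rightarrow>\<^sub>0 'k) module)"
      by (rule vector_space_on_Mag)
    show "\<sigma> permutes {1..n} \<Longrightarrow>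
        linear_map (cpt Mag n) (cpt Mag n) (act Mag n \<sigma> :: (nat word \<Rightarrow>\<^sub>0 'k) \<Rightarrow> _)"
      by (rule Mag_act_linear)
    assume f: "f \<in> elems Mag n"
    show "act Mag n id f = f"
      by (rule eqI[OF Mag_act_linear[OF permutes_id] linear_map_ident _ f])
        (simp add: Mag_act_wd word.map_id)
    have one: "wd x\<^sub>1 \<in> elems Mag 1"
      by (auto simp: multilinear_words_def)
    have lin: "linear_map (cpt Mag n) (cpt Mag n) (pcomp Mag 1 n 1 (wd x\<^sub>1) :: _ \<Rightarrow> nat word \<Rightarrow>\<^sub>0 'k)"
      using Mag_pcomp_linear_right[of 1 1 n "wd x\<^sub>1"] n one by simp
    show "pcomp Mag 1 n 1 (ident Mag) f = f"
      unfolding Mag_simps by (rule eqI[OF lin linear_map_ident _ f]) (simp only: Mag_pcomp_wd graft_Var_left)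
    assume \<sigma>: "\<sigma> permutes {1..n}" and \<tau>: "\<tau> permutes {1..n}"
    show "act Mag n (\<sigma> \<circ> \<tau>) f = act Mag n \<sigma> (act Mag n \<tau> f)"
      by (rule eqI[OF Mag_act_linear[OF permutes_compose[OF \<tau> \<sigma>]]
            linear_map_compose[OF Mag_act_linear[OF \<tau>] Mag_act_linear[OF \<sigma>]] _ f])
        (simp add: Mag_act_wd word.map_comp)
  next
    show "ident Mag \<in> elems Mag 1"
      by (auto simp: multilinear_words_def)
  next
    fix i n :: nat and f :: "nat word \<Rightarrow>\<^sub>0 'k"
    assume i: "i \<in> {1..n}" and f: "f \<in> elems Mag n"
    have lin: "linear_map (cpt Mag n) (cpt Mag n) (\<lambda>f. pcomp Mag n 1 i f (wd x\<^sub>1 :: nat word \<Rightarrow>\<^sub>0 'k))"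
      using Mag_pcomp_linear_left[of i n 1 "wd x\<^sub>1"] i by (auto simp: multilinear_words_def)
    show "pcomp Mag n 1 i f (ident Mag) = f"
      unfolding Mag_simps by (rule eqI[OF lin linear_map_ident _ f]) (simp only: Mag_pcomp_wd graft_Var_right)
  next
    fix i m n :: nat and f g :: "nat word \<Rightarrow>\<^sub>0 'k" and \<sigma> \<tau>
    assume i: "i \<in> {1..m}" and n: "1 \<le> n"
    show "g \<in> elems Mag n \<Longrightarrow>
        linear_map (cpt Mag m) (cpt Mag (m + n - 1)) (\<lambda>f. pcomp Mag m n i f g)"
      by (rule Mag_pcomp_linear_left[OF i n])
    show "f \<in> elems Mag m \<Longrightarrow>
        linear_map (cpt Mag n) (cpt Mag (m + n - 1)) (pcomp Mag m n i f)"
      by (rule Mag_pcomp_linear_right[OF i n])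
    assume \<sigma>: "\<sigma> permutes {1..m}" and \<tau>: "\<tau> permutes {1..n}"
      and f: "f \<in> elems Mag m" and g: "g \<in> elems Mag n"
    have \<sigma>i: "\<sigma> i \<in> {1..m}" using permutes_in_image[OF \<sigma>] i by blast
    have block: "block_perm n i \<sigma> \<tau> permutes {1..m + n - 1}"
      by (rule block_perm_permutes[OF i n \<sigma> \<tau>])
    have words: "pcomp Mag m n (\<sigma> i) (act Mag m \<sigma> (wd s)) (act Mag n \<tau> (wd t)) =
        act Mag (m + n - 1) (block_perm n i \<sigma> \<tau>) (pcomp Mag m n i (wd s) (wd t :: nat word \<Rightarrow>\<^sub>0 'k))"
      if "t \<in> multilinear_words n" for s t
      unfolding Mag_act_wd Mag_pcomp_wd
      using that by (subst graft_equivariant[OF permutes_inj[OF \<sigma>]]) (auto simp: multilinear_words_def)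
    have act\<sigma>: "act Mag m \<sigma> f \<in> elems Mag m" if "f \<in> elems Mag m" for f :: "nat word \<Rightarrow>\<^sub>0 'k"
      using linear_map_closed[OF Mag_act_linear[OF \<sigma>]] that .
    have act\<tau>: "act Mag n \<tau> g \<in> elems Mag n"
      using linear_map_closed[OF Mag_act_linear[OF \<tau>]] g .
    have *: "pcomp Mag m n (\<sigma> i) (act Mag m \<sigma> (wd s)) (act Mag n \<tau> g) =
        act Mag (m + n - 1) (block_perm n i \<sigma> \<tau>) (pcomp Mag m n i (wd s) g)"
      if "s \<in> multilinear_words m" for s
      by (rule eqI[OF linear_map_compose[OF Mag_act_linear[OF \<tau>] Mag_pcomp_linear_right[OF \<sigma>i n act\<sigma>]]
            linear_map_compose[OF Mag_pcomp_linear_right[OF i n wd_closed] Mag_act_linear[OF block]] words g])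
        (use that wd_closed in auto)
    show "pcomp Mag m n (\<sigma> i) (act Mag m \<sigma> f) (act Mag n \<tau> g) =
        act Mag (m + n - 1) (block_perm n i \<sigma> \<tau>) (pcomp Mag m n i f g)"
      by (rule eqI[OF linear_map_compose[OF Mag_act_linear[OF \<sigma>] Mag_pcomp_linear_left[OF \<sigma>i n act\<tau>]]
            linear_map_compose[OF Mag_pcomp_linear_left[OF i n g] Mag_act_linear[OF block]] * f])
  next
    fix i j l m n :: nat and f g h :: "nat word \<Rightarrow>\<^sub>0 'k"
    assume i: "i \<in> {1..l}" and j: "j \<in> {1..m}" and n: "1 \<le> n"
      and f: "f \<in> elems Mag l" and g: "g \<in> elems Mag m" and h: "h \<in> elems Mag n"
    have m: "1 \<le> m" and mn: "1 \<le> m + n - 1" and ij: "i + j - 1 \<in> {1..l + m - 1}"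
      and arity: "l + (m + n - 1) - 1 = (l + m - 1) + n - 1"
      using i j n by auto
    note L1 = linear_map_compose[OF Mag_pcomp_linear_left[OF i m] Mag_pcomp_linear_left[OF ij n]]
    note L2 = linear_map_compose[OF Mag_pcomp_linear_right[OF i m] Mag_pcomp_linear_left[OF ij n]]
    note L3 = Mag_pcomp_linear_right[OF ij n]
    note R1 = Mag_pcomp_linear_left[OF i mn, unfolded arity]
    note R2 = linear_map_compose[OF Mag_pcomp_linear_left[OF j n]
        Mag_pcomp_linear_right[OF i mn, unfolded arity]]
    note R3 = linear_map_compose[OF Mag_pcomp_linear_right[OF j n]
        Mag_pcomp_linear_right[OF i mn, unfolded arity]]
    let ?E = "\<lambda>f g h. pcomp Mag (l + m - 1) n (i + j - 1) (pcomp Mag l m i f g) h =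
        pcomp Mag l (m + n - 1) i f (pcomp Mag m n j g (h :: nat word \<Rightarrow>\<^sub>0 'k))"
    have words: "?E (wd s) (wd t) (wd u)" if "t \<in> multilinear_words m" for s t u
      unfolding Mag_pcomp_wd using graft_sequential[OF j multilinear_ge_one[OF that] n] by simp
    have words': "?E (wd s) (wd t) h" if "s \<in> multilinear_words l" "t \<in> multilinear_words m" for s t
      by (rule eqI[OF L3[OF Mag_pcomp_closed[OF i m wd_closed[OF that(1)] wd_closed[OF that(2)]]] R3 _ h]) (use that wd_closed words in \<open>auto simp del: Mag_simps\<close>)
    have words'': "?E (wd s) g h" if "s \<in> multilinear_words l" for s
      by (rule eqI[OF L2 R2 _ g]) (use that wd_closed h words' in \<open>auto simp del: Mag_simps\<close>)
    show "?E f g h"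
      by (rule eqI[OF L1 R1[OF Mag_pcomp_closed[OF j n g h]] _ f]) (use wd_closed g h words'' in \<open>auto simp del: Mag_simps\<close>)
  next
    fix i j l m n :: nat and f g h :: "nat word \<Rightarrow>\<^sub>0 'k"
    assume i: "i \<in> {1..l}" and j: "j \<in> {1..l}" and ij: "i < j" and m: "1 \<le> m" and n: "1 \<le> n"
      and f: "f \<in> elems Mag l" and g: "g \<in> elems Mag m" and h: "h \<in> elems Mag n"
    have jm: "j + m - 1 \<in> {1..l + m - 1}" and il: "i \<in> {1..l + n - 1}"
      and arity: "(l + n - 1) + m - 1 = (l + m - 1) + n - 1"
      using i j m n by auto
    note L1 = linear_map_compose[OF Mag_pcomp_linear_left[OF i m] Mag_pcomp_linear_left[OF jm n]]
    note L2 = linear_map_compose[OF Mag_pcomp_linear_right[OF i m] Mag_pcomp_linear_left[OF jm n]]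
    note L3 = Mag_pcomp_linear_right[OF jm n]
    note R1 = linear_map_compose[OF Mag_pcomp_linear_left[OF j n]
        Mag_pcomp_linear_left[OF il m, unfolded arity]]
    note R2 = Mag_pcomp_linear_right[OF il m, unfolded arity]
    note R3 = linear_map_compose[OF Mag_pcomp_linear_right[OF j n]
        Mag_pcomp_linear_left[OF il m, unfolded arity]]
    let ?E = "\<lambda>f g h. pcomp Mag (l + m - 1) n (j + m - 1) (pcomp Mag l m i f g) h =
        pcomp Mag (l + n - 1) m i (pcomp Mag l n j f h) (g :: nat word \<Rightarrow>\<^sub>0 'k)"
    have words: "?E (wd s) (wd t) (wd u)" if "t \<in> multilinear_words m" "u \<in> multilinear_words n" for s t u
      unfolding Mag_pcomp_wd using graft_parallel[OF ij multilinear_ge_one[OF that(2)] _ m n] that(1)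
      by (simp add: multilinear_words_def)
    have words': "?E (wd s) (wd t) h" if "s \<in> multilinear_words l" "t \<in> multilinear_words m" for s t
      by (rule eqI[OF L3[OF Mag_pcomp_closed[OF i m wd_closed[OF that(1)] wd_closed[OF that(2)]]] R3 _ h]) (use that wd_closed words in \<open>auto simp del: Mag_simps\<close>)
    have words'': "?E (wd s) g h" if "s \<in> multilinear_words l" for s
      by (rule eqI[OF L2 R2[OF Mag_pcomp_closed[OF j n wd_closed[OF that] h]] _ g]) (use that wd_closed h words' in \<open>auto simp del: Mag_simps\<close>)
    show "?E f g h"
      by (rule eqI[OF L1 R1 _ f]) (use wd_closed g h words'' in \<open>auto simp del: Mag_simps\<close>)
  qed
qed


section \<open>Freeness of the operad of words\<close>

text \<open>
  The value at a binary operation \<open>a\<close> of the bracketing of a word, with inputs numbered from left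
  to right whatever the variables are.  The right factor is inserted first, at input 2 of \<open>a\<close>, so
  that the left factor still goes to input 1.
\<close>

primrec planar_eval :: "('k, 'a) operad \<Rightarrow> 'a \<Rightarrow> 'v word \<Rightarrow> 'a" where
  "planar_eval P a (Var v) = ident P"
| "planar_eval P a (s \<cdot> t) =
    pcomp P (length (vars t) + 1) (length (vars s)) 1
      (pcomp P 2 (length (vars t)) 2 a (planar_eval P a t)) (planar_eval P a s)"

text \<open>
  Sends the position of a leaf, counted from the left and from 1, to the variable at this leaf.  It
  is the identity elsewhere, as \<open>permutes\<close> requires.
\<close>

definition leaf_perm :: "nat word \<Rightarrow> nat \<Rightarrow> nat" where
  "leaf_perm t k = (if k \<in> {1..length (vars t)} then vars t ! (k - 1) else k)"

definition word_eval :: "('k, 'a) operad \<Rightarrow> 'a \<Rightarrow> nat \<Rightarrow> nat word \<Rightarrow> 'a" where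
  "word_eval P a n t = act P n (leaf_perm t) (planar_eval P a t)"

definition Mag_hom :: "('k::field, 'a) operad \<Rightarrow> 'a \<Rightarrow> nat \<Rightarrow> (nat word \<Rightarrow>\<^sub>0 'k) \<Rightarrow> 'a" where
  "Mag_hom P a n f = (\<Oplus>\<^bsub>cpt P n\<^esub>t\<in>Poly_Mapping.keys f.
     Poly_Mapping.lookup f t \<odot>\<^bsub>cpt P n\<^esub> word_eval P a n t)"

lemma generator_multilinear: "x\<^sub>1 \<cdot> x\<^sub>2 \<in> multilinear_words 2"
  by (auto simp: multilinear_words_def)

lemma length_vars_ge_one: "1 \<le> length (vars t)"
  by (simp add: Suc_leI)

lemma planar_eval_map_word [simp]: "planar_eval P a (map_word h t) = planar_eval P a t"
  by (induction t) simp_all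

lemma (in operad) planar_eval_closed:
  assumes a: "a \<in> elems P 2"
  shows "planar_eval P a t \<in> elems P (length (vars t))"
proof (induction t)
  case (Var v)
  then show ?case using ident_closed by simp
next
  case (Mul s t)
  have "pcomp P 2 (length (vars t)) 2 a (planar_eval P a t) \<in> elems P (2 + length (vars t) - 1)"
    by (rule pcomp_closed[OF _ length_vars_ge_one a Mul.IH(2)]) simp
  then have "pcomp P 2 (length (vars t)) 2 a (planar_eval P a t) \<in> elems P (length (vars t) + 1)"
    by simp
  from pcomp_closed[OF _ length_vars_ge_one this Mul.IH(1), of 1]
  show ?case by (simp add: add.commute)
qed

text \<open>
  For a product \<open>s\<^sub>1 \<cdot> s\<^sub>2\<close>, the value is \<open>(a \<circ>\<^sub>2 E s\<^sub>2) \<circ>\<^sub>1 E s\<^sub>1\<close>.  Grafting into \<open>s\<^sub>1\<close> is sequential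
  associativity at input 1.  Grafting into \<open>s\<^sub>2\<close> is sequential associativity at input 2, and
  parallel associativity then moves the grafted operation past the insertion of \<open>E s\<^sub>1\<close>.
\<close>

lemma (in operad) planar_eval_graft:
  assumes a: "a \<in> elems P 2" and s: "vars s = xs @ i # ys" "i \<notin> set xs" "i \<notin> set ys"
    and n: "length (vars t) = n"
  shows "planar_eval P a (graft n i s t) =
    pcomp P (length (vars s)) n (length xs + 1) (planar_eval P a s) (planar_eval P a t)"
  using s
proof (induction s arbitrary: xs ys)
  case (Var v)
  then have "v = i" "xs = []" by (auto simp: Cons_eq_append_conv)
  then show ?case
    using ident_left[of n "planar_eval P a t"] planar_eval_closed[OF a, of t] n length_vars_ge_one[of t]
    by simp
next
  case (Mul s\<^sub>1 s\<^sub>2)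
  let ?E = "planar_eval P a"
  let ?p = "length (vars s\<^sub>1)" and ?q = "length (vars s\<^sub>2)"
  note closed = planar_eval_closed[OF a]
  have n1: "1 \<le> n" using n length_vars_ge_one by metis
  have t: "?E t \<in> elems P n" using closed[of t] n by simp
  have two: "2 \<in> {1..2::nat}" by simp
  have top: "pcomp P 2 ?q 2 a (?E s\<^sub>2) \<in> elems P (?q + 1)"
    using pcomp_closed[OF two length_vars_ge_one a closed[of s\<^sub>2]] by simp
  have one: "1 \<in> {1..?q + 1}" by simp
  from Mul.prems(1) consider
    (left) zs where "vars s\<^sub>1 = xs @ i # zs" "ys = zs @ vars s\<^sub>2"
    | (right) zs where "xs = vars s\<^sub>1 @ zs" "vars s\<^sub>2 = zs @ i # ys"
    by (auto simp: append_eq_append_conv2 append_eq_Cons_conv)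
  then show ?case
  proof cases
    case left
    have g1: "length (vars (graft n i s\<^sub>1 t)) = ?p + n - 1"
      using Mul.prems left by (subst vars_graft[OF left(1)]) (auto simp: n)
    have "i \<notin> set (vars s\<^sub>2)" using Mul.prems left by simp
    then have g2: "graft n i s\<^sub>2 t = map_word (skip_block n i) s\<^sub>2"
      by (rule graft_eq_map_word)
    have IH: "?E (graft n i s\<^sub>1 t) = pcomp P ?p n (length xs + 1) (?E s\<^sub>1) (?E t)"
      using Mul.IH(1)[OF left(1)] Mul.prems left by simp
    have k: "length xs + 1 \<in> {1..?p}" using left by simp
    have "?E (graft n i (s\<^sub>1 \<cdot> s\<^sub>2) t) = pcomp P (?q + 1) (?p + n - 1) 1
        (pcomp P 2 ?q 2 a (?E s\<^sub>2)) (pcomp P ?p n (length xs + 1) (?E s\<^sub>1) (?E t))"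
      by (simp add: g1 g2 IH)
    also have "\<dots> = pcomp P (?q + 1 + ?p - 1) n (1 + (length xs + 1) - 1)
        (pcomp P (?q + 1) ?p 1 (pcomp P 2 ?q 2 a (?E s\<^sub>2)) (?E s\<^sub>1)) (?E t)"
      by (rule assoc_sequential[OF one k n1 top closed t, symmetric])
    finally show ?thesis by (simp add: add.commute)
  next
    case right
    have g2: "length (vars (graft n i s\<^sub>2 t)) = ?q + n - 1"
      using Mul.prems right by (subst vars_graft[OF right(2)]) (auto simp: n)
    have "i \<notin> set (vars s\<^sub>1)" using Mul.prems right by simp
    then have g1: "graft n i s\<^sub>1 t = map_word (skip_block n i) s\<^sub>1"
      by (rule graft_eq_map_word)
    have IH: "?E (graft n i s\<^sub>2 t) = pcomp P ?q n (length zs + 1) (?E s\<^sub>2) (?E t)"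
      using Mul.IH(2)[OF right(2)] Mul.prems right by simp
    have k: "length zs + 1 \<in> {1..?q}" and k': "length zs + 2 \<in> {1..?q + 1}"
      using right by simp_all
    have "?E (graft n i (s\<^sub>1 \<cdot> s\<^sub>2) t) = pcomp P (?q + n) ?p 1
        (pcomp P 2 (?q + n - 1) 2 a (pcomp P ?q n (length zs + 1) (?E s\<^sub>2) (?E t))) (?E s\<^sub>1)"
      using n1 by (simp add: g1 g2 IH)
    also have "pcomp P 2 (?q + n - 1) 2 a (pcomp P ?q n (length zs + 1) (?E s\<^sub>2) (?E t)) =
        pcomp P (?q + 1) n (length zs + 2) (pcomp P 2 ?q 2 a (?E s\<^sub>2)) (?E t)"
      using assoc_sequential[OF two k n1 a closed t] by simp
    also have "pcomp P (?q + n) ?p 1 \<dots> (?E s\<^sub>1) =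
        pcomp P (?q + 1 + ?p - 1) n (length zs + 2 + ?p - 1)
          (pcomp P (?q + 1) ?p 1 (pcomp P 2 ?q 2 a (?E s\<^sub>2)) (?E s\<^sub>1)) (?E t)"
      using assoc_parallel[OF one k' _ length_vars_ge_one n1 top closed t, of s\<^sub>1] by simp
    finally show ?thesis using right by (simp add: add.commute add.left_commute)
  qed
qed

lemma leaf_perm_permutes:
  assumes t: "t \<in> multilinear_words n"
  shows "leaf_perm t permutes {1..n}"
proof (rule bij_imp_permutes)
  have len: "length (vars t) = n" by (rule length_vars_multilinear[OF t])
  have "bij_betw ((!) (vars t)) {..<n} {1..n}"
    using t len by (intro bij_betw_nth) (auto simp: multilinear_words_def)
  moreover have "bij_betw (\<lambda>k. k - 1) {1..n} {..<n}"
    by (rule bij_betw_byWitness[where f' = Suc]) auto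
  ultimately have "bij_betw ((!) (vars t) \<circ> (\<lambda>k. k - 1)) {1..n} {1..n}"
    by (rule bij_betw_trans[rotated])
  then show "bij_betw (leaf_perm t) {1..n} {1..n}"
    by (rule bij_betw_cong[THEN iffD1, rotated]) (auto simp: leaf_perm_def len)
qed (use length_vars_multilinear[OF t] in \<open>auto simp: leaf_perm_def\<close>)

lemma leaf_perm_map_word:
  assumes t: "t \<in> multilinear_words n" and \<sigma>: "\<sigma> permutes {1..n}"
  shows "leaf_perm (map_word \<sigma> t) = \<sigma> \<circ> leaf_perm t"
proof
  fix k
  show "leaf_perm (map_word \<sigma> t) k = (\<sigma> \<circ> leaf_perm t) k"
    using permutes_not_in[OF \<sigma>, of k] length_vars_multilinear[OF t]
    by (auto simp: leaf_perm_def)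
qed

text \<open>
  Graft the planar words first and rename afterwards: the renaming is the block permutation of the
  two renamings, where \<open>length xs + 1\<close> is the position of the leaf \<open>i\<close>.
\<close>

lemma leaf_perm_graft:
  assumes s: "s \<in> multilinear_words m" and t: "t \<in> multilinear_words n"
    and xy: "vars s = xs @ i # ys" "i \<notin> set xs" "i \<notin> set ys"
  shows "leaf_perm (graft n i s t) = block_perm n (length xs + 1) (leaf_perm s) (leaf_perm t)"
proof
  fix k
  let ?l = "length xs"
  have n: "length (vars t) = n" by (rule length_vars_multilinear[OF t])
  have n1: "1 \<le> n" using n length_vars_ge_one by metis
  have i: "leaf_perm s (?l + 1) = i" by (simp add: leaf_perm_def xy)
  have v: "vars (graft n i s t) =
      map (skip_block n i) xs @ map (\<lambda>p. i + p - 1) (vars t) @ map (skip_block n i) ys"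
    by (rule vars_graft[OF xy])
  have i1: "1 \<le> i" using s xy by (auto simp: multilinear_words_def)
  have im: "i \<le> m" using s xy by (auto simp: multilinear_words_def)
  have m: "m = ?l + 1 + length ys" using length_vars_multilinear[OF s] xy by simp
  consider "k = 0" | "1 \<le> k" "k \<le> ?l" | "?l < k" "k \<le> ?l + n"
    | "?l + n < k" "k \<le> ?l + n + length ys" | "?l + n + length ys < k" by linarith
  then show "leaf_perm (graft n i s t) k = block_perm n (?l + 1) (leaf_perm s) (leaf_perm t) k"
  proof cases
    case 1
    then show ?thesis using i1 unfolding block_perm_def i by (simp add: leaf_perm_def skip_block_def)
  next
    case 2
    then have "k - 1 < ?l" by linarith
    with 2 have "leaf_perm s k = xs ! (k - 1)"
      by (simp add: leaf_perm_def xy nth_append)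
    moreover have "leaf_perm (graft n i s t) k = skip_block n i (xs ! (k - 1))"
      using 2 \<open>k - 1 < ?l\<close> by (simp add: leaf_perm_def v nth_append)
    ultimately show ?thesis using 2 unfolding block_perm_def i by simp
  next
    case 3
    then have "k - (?l + 1) + 1 \<in> {1..n}" by auto
    then have "leaf_perm t (k - (?l + 1) + 1) = vars t ! (k - ?l - 1)"
      unfolding leaf_perm_def n by simp
    moreover have "leaf_perm (graft n i s t) k = i + vars t ! (k - ?l - 1) - 1"
      using 3 n by (auto simp add: leaf_perm_def v nth_append diff_diff_left)
    ultimately show ?thesis using 3 unfolding block_perm_def i by simp
  next
    case 4
    define j where "j = k - ?l - n - 1"
    have k: "k = ?l + n + j + 1" and j: "j < length ys" using 4 by (auto simp: j_def)
    have "leaf_perm s (k - n + 1) = ys ! j"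
      using j by (simp add: leaf_perm_def xy k nth_append)
    moreover have "leaf_perm (graft n i s t) k = skip_block n i (ys ! j)"
      using j n by (simp add: leaf_perm_def v k nth_append)
    ultimately show ?thesis using 4 unfolding block_perm_def i by simp
  next
    case 5
    then have "k - n + 1 \<notin> {1..length (vars s)}" using xy by auto
    then have "leaf_perm s (k - n + 1) = k - n + 1"
      by (simp only: leaf_perm_def if_False)
    moreover have "leaf_perm (graft n i s t) k = k"
      using 5 n by (simp add: leaf_perm_def v)
    moreover have "skip_block n i (k - n + 1) = k"
      using 5 n1 im m by (auto simp: skip_block_def)
    ultimately show ?thesis using 5 unfolding block_perm_def i by simp
  qed
qed

context operad
begin

lemma word_eval_closed:
  assumes "a \<in> elems P 2" "t \<in> multilinear_words n"
  shows "word_eval P a n t \<in> elems P n"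
  using act_closed[OF _ leaf_perm_permutes[OF assms(2)]] planar_eval_closed[OF assms(1), of t]
    length_vars_multilinear[OF assms(2)] length_vars_ge_one[of t]
  unfolding word_eval_def by simp

lemma word_eval_map_word:
  assumes a: "a \<in> elems P 2" and t: "t \<in> multilinear_words n" and \<sigma>: "\<sigma> permutes {1..n}"
  shows "word_eval P a n (map_word \<sigma> t) = act P n \<sigma> (word_eval P a n t)"
  using act_comp[OF _ \<sigma> leaf_perm_permutes[OF t]] planar_eval_closed[OF a, of t]
    length_vars_multilinear[OF t] length_vars_ge_one[of t]
  unfolding word_eval_def leaf_perm_map_word[OF t \<sigma>] by simp

text \<open>
  Equivariance in \<open>P\<close> separates the two permutations of leaves from the planar composition.
\<close>

lemma word_eval_graft:
  assumes a: "a \<in> elems P 2" and i: "i \<in> {1..m}"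
    and s: "s \<in> multilinear_words m" and t: "t \<in> multilinear_words n"
  shows "word_eval P a (m + n - 1) (graft n i s t) =
    pcomp P m n i (word_eval P a m s) (word_eval P a n t)"
proof -
  obtain xs ys where xy: "vars s = xs @ i # ys" "i \<notin> set xs" "i \<notin> set ys"
    using multilinear_split[OF s i] .
  let ?k = "length xs + 1"
  have m: "length (vars s) = m" and n: "length (vars t) = n"
    using length_vars_multilinear s t by auto
  have n1: "1 \<le> n" using n length_vars_ge_one by metis
  have k: "?k \<in> {1..m}" using m xy by simp
  have i': "leaf_perm s ?k = i" by (simp add: leaf_perm_def xy)
  have "planar_eval P a s \<in> elems P m" "planar_eval P a t \<in> elems P n"
    using planar_eval_closed[OF a] m n by metis+
  from equivariant[OF k n1 leaf_perm_permutes[OF s] leaf_perm_permutes[OF t] this]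
  show ?thesis
    unfolding word_eval_def leaf_perm_graft[OF s t xy] planar_eval_graft[OF a xy n] i' m by simp
qed

end

lemma linear_extension:
  fixes N :: "('k::field, 'a) module"
  assumes N: "vector_space_on N" and e: "\<And>t. t \<in> multilinear_words n \<Longrightarrow> e t \<in> carrier N"
  defines "L \<equiv> \<lambda>f. \<Oplus>\<^bsub>N\<^esub>t\<in>Poly_Mapping.keys f. Poly_Mapping.lookup f t \<odot>\<^bsub>N\<^esub> e t"
  shows "linear_map (cpt Mag n) N L"
    and "\<And>t. t \<in> multilinear_words n \<Longrightarrow> L (wd t) = e t"
proof -
  interpret abelian_group N by (rule vs_abelian_group[OF N])
  have closed: "c \<odot>\<^bsub>N\<^esub> e t \<in> carrier N" if "t \<in> multilinear_words n" for c t
    using vs_smult_closed[OF N] e that by blast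
  \<comment> \<open>Sums over different supports are compared over a common finite set of words.\<close>
  have L: "L f = (\<Oplus>\<^bsub>N\<^esub>t\<in>A. Poly_Mapping.lookup f t \<odot>\<^bsub>N\<^esub> e t)"
    if "Poly_Mapping.keys f \<subseteq> A" "finite A" "A \<subseteq> multilinear_words n" for f A
    unfolding L_def
    by (rule add.finprod_mono_neutral_cong_left)
      (use that closed vs_smult_zero[OF N e] in \<open>auto simp: in_keys_iff\<close>)
  show "linear_map (cpt Mag n) N L"
  proof (rule linear_mapI)
    fix f g :: "nat word \<Rightarrow>\<^sub>0 'k" and c
    assume f: "f \<in> elems Mag n"
    then have f': "Poly_Mapping.keys f \<subseteq> multilinear_words n" by simp
    show "L f \<in> carrier N"
      unfolding L_def by (rule finsum_closed) (use closed f' in auto)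
    have "L (c \<odot>\<^bsub>cpt Mag n\<^esub> f) =
        (\<Oplus>\<^bsub>N\<^esub>t\<in>Poly_Mapping.keys f. (c * Poly_Mapping.lookup f t) \<odot>\<^bsub>N\<^esub> e t)"
      using L[of "Poly_Mapping.map ((*) c) f" "Poly_Mapping.keys f"] keys_scale[of c f] f' by simp
    also have "\<dots> = (\<Oplus>\<^bsub>N\<^esub>t\<in>Poly_Mapping.keys f. c \<odot>\<^bsub>N\<^esub> (Poly_Mapping.lookup f t \<odot>\<^bsub>N\<^esub> e t))"
      by (rule finsum_cong') (use f' e closed vs_smult_assoc[OF N] vs_smult_closed[OF N] in auto)
    also have "\<dots> = c \<odot>\<^bsub>N\<^esub> L f"
      unfolding L_def
      by (rule module.finsum_smult_ldistr[OF N, symmetric])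
        (use f' closed in \<open>auto simp: ring_of_type_algebra_def\<close>)
    finally show "L (c \<odot>\<^bsub>cpt Mag n\<^esub> f) = c \<odot>\<^bsub>N\<^esub> L f" .
    assume g: "g \<in> elems Mag n"
    let ?A = "Poly_Mapping.keys f \<union> Poly_Mapping.keys g"
    have A: "?A \<subseteq> multilinear_words n" using f g by simp
    have "L (f \<oplus>\<^bsub>cpt Mag n\<^esub> g) = (\<Oplus>\<^bsub>N\<^esub>t\<in>?A. Poly_Mapping.lookup (f + g) t \<odot>\<^bsub>N\<^esub> e t)"
      using L[OF Poly_Mapping.keys_add _ A] by simp
    also have "\<dots> = (\<Oplus>\<^bsub>N\<^esub>t\<in>?A. Poly_Mapping.lookup f t \<odot>\<^bsub>N\<^esub> e t \<oplus>\<^bsub>N\<^esub> Poly_Mapping.lookup g t \<odot>\<^bsub>N\<^esub> e t)"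
      by (rule finsum_cong') (use A e closed vs_smult_l_distr[OF N] in \<open>auto simp: lookup_add\<close>)
    also have "\<dots> = L f \<oplus>\<^bsub>N\<^esub> L g"
      using A closed by (subst finsum_addf) (auto simp: L[OF _ _ A])
    finally show "L (f \<oplus>\<^bsub>cpt Mag n\<^esub> g) = L f \<oplus>\<^bsub>N\<^esub> L g" .
  qed
  show "L (wd t) = e t" if "t \<in> multilinear_words n" for t
    using that e vs_smult_one[OF N] by (simp add: L_def)
qed

text \<open>
  The operad of words is free on its generator \<open>x\<^sub>1 x\<^sub>2\<close>: any element of arity 2 of any operad is the
  image of the generator under a morphism, namely the linear extension of the evaluation of words.
\<close>

theorem (in operad) Mag_hom:
  assumes a: "a \<in> elems P 2"
  shows operad_hom_Mag_hom: "operad_hom Mag P (Mag_hom P a)"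
    and Mag_hom_generator: "Mag_hom P a 2 (wd (x\<^sub>1 \<cdot> x\<^sub>2)) = a"
proof -
  have ext: "linear_map (cpt Mag n) (cpt P n) (Mag_hom P a n)"
    "\<And>t. t \<in> multilinear_words n \<Longrightarrow> Mag_hom P a n (wd t) = word_eval P a n t" if "1 \<le> n" for n
    using linear_extension[OF cpt_module[OF that], of n "word_eval P a n"] word_eval_closed[OF a]
    unfolding Mag_hom_def by blast+
  interpret M: operad Mag by (rule operad_Mag)
  show "operad_hom Mag P (Mag_hom P a)"
  proof (rule operad_homI)
    fix n :: nat and \<sigma> and f :: "nat word \<Rightarrow>\<^sub>0 'k"
    assume n: "1 \<le> n"
    show lin: "linear_map (cpt Mag n) (cpt P n) (Mag_hom P a n)"
      by (rule ext(1)[OF n])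
    assume \<sigma>: "\<sigma> permutes {1..n}" and f: "f \<in> elems Mag n"
    show "Mag_hom P a n (act Mag n \<sigma> f) = act P n \<sigma> (Mag_hom P a n f)"
      by (rule linear_map_Mag_eqI[OF cpt_module[OF n] linear_map_compose[OF Mag_act_linear[OF \<sigma>] lin]
            linear_map_compose[OF lin act_linear[OF n \<sigma>]] _ f])
        (simp add: Mag_act_wd ext(2)[OF n] map_word_multilinear[OF \<sigma>] word_eval_map_word[OF a _ \<sigma>])
  next
    have "leaf_perm x\<^sub>1 = id"
      by (auto simp: leaf_perm_def fun_eq_iff)
    then have "word_eval P a 1 x\<^sub>1 = ident P"
      unfolding word_eval_def using act_id[OF _ ident_closed] by simp
    then show "Mag_hom P a 1 (ident Mag) = ident P"
      using ext(2)[of 1 x\<^sub>1] by (simp add: multilinear_words_def)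
  next
    fix m n i :: nat and f g :: "nat word \<Rightarrow>\<^sub>0 'k"
    assume m: "1 \<le> m" and n: "1 \<le> n" and i: "i \<in> {1..m}"
      and f: "f \<in> elems Mag m" and g: "g \<in> elems Mag n"
    have mn: "1 \<le> m + n - 1" using m n by simp
    have words: "Mag_hom P a (m + n - 1) (pcomp Mag m n i (wd s) (wd t)) =
        pcomp P m n i (Mag_hom P a m (wd s)) (Mag_hom P a n (wd t))"
      if "s \<in> multilinear_words m" "t \<in> multilinear_words n" for s t
      using that ext(2)[OF m that(1)] ext(2)[OF n that(2)] ext(2)[OF mn graft_multilinear[OF i n that]]
        word_eval_graft[OF a i that]
      by (simp add: Mag_pcomp_wd)
    have *: "Mag_hom P a (m + n - 1) (pcomp Mag m n i (wd s) g) =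
        pcomp P m n i (Mag_hom P a m (wd s)) (Mag_hom P a n g)"
      if s: "s \<in> multilinear_words m" for s
    proof -
      have wd: "wd s \<in> elems Mag m" using s by simp
      have L: "linear_map (cpt Mag n) (cpt P (m + n - 1)) (\<lambda>g. Mag_hom P a (m + n - 1) (pcomp Mag m n i (wd s) g))"
        by (rule linear_map_compose[OF M.pcomp_linear_right[OF i n wd] ext(1)[OF mn]])
      have R: "linear_map (cpt Mag n) (cpt P (m + n - 1)) (\<lambda>g. pcomp P m n i (Mag_hom P a m (wd s)) (Mag_hom P a n g))"
        by (rule linear_map_compose[OF ext(1)[OF n] pcomp_linear_right[OF i n
                linear_map_closed[OF ext(1)[OF m] wd]]])
      show ?thesis
        by (rule linear_map_Mag_eqI[OF cpt_module[OF mn] L R words[OF s] g])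
    qed
    show "Mag_hom P a (m + n - 1) (pcomp Mag m n i f g) =
        pcomp P m n i (Mag_hom P a m f) (Mag_hom P a n g)"
      by (rule linear_map_Mag_eqI[OF cpt_module[OF mn]
            linear_map_compose[OF M.pcomp_linear_left[OF i n g] ext(1)[OF mn]]
            linear_map_compose[OF ext(1)[OF m] pcomp_linear_left[OF i n linear_map_closed[OF ext(1)[OF n] g]]]
            * f])
  qed
  have "leaf_perm (x\<^sub>1 \<cdot> x\<^sub>2) = id"
    by (auto simp: leaf_perm_def fun_eq_iff nth_Cons split: nat.split)
  moreover have "pcomp P 2 1 1 (pcomp P 2 1 2 a (ident P)) (ident P) = a"
    using ident_right[OF _ a] by simp
  ultimately have "word_eval P a 2 (x\<^sub>1 \<cdot> x\<^sub>2) = a"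
    unfolding word_eval_def using act_id[OF _ a] by (simp add: numeral_2_eq_2)
  then show "Mag_hom P a 2 (wd (x\<^sub>1 \<cdot> x\<^sub>2)) = a"
    using ext(2)[OF _ generator_multilinear] by simp
qed

text \<open>
  The word of the same bracketing whose variables are \<open>k, k + 1, \<dots>\<close> from left to right.
\<close>

primrec relabel :: "nat \<Rightarrow> 'v word \<Rightarrow> nat word" where
  "relabel k (Var v) = Var k"
| "relabel k (s \<cdot> t) = relabel k s \<cdot> relabel (k + length (vars s)) t"

lemma map_word_relabel:
  "(\<And>j. j < length (vars t) \<Longrightarrow> h (k + j) = vars t ! j) \<Longrightarrow> map_word h (relabel k t) = t"
proof (induction t arbitrary: k)
  case (Var v)
  show ?case using Var[of 0] by simp
next
  case (Mul s t)
  have "map_word h (relabel k s) = s"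
    by (rule Mul.IH(1)) (use Mul.prems in \<open>auto simp: nth_append split: if_splits\<close>)
  moreover have "map_word h (relabel (k + length (vars s)) t) = t"
  proof (rule Mul.IH(2))
    fix j assume "j < length (vars t)"
    then show "h (k + length (vars s) + j) = vars t ! j"
      using Mul.prems[of "length (vars s) + j"] by (simp add: add.assoc)
  qed
  ultimately show ?case by simp
qed

lemma relabel_Suc: "map_word Suc (relabel k t) = relabel (Suc k) t"
  by (induction t arbitrary: k) simp_all

lemma relabel_shift: "map_word ((+) d) (relabel k t) = relabel (d + k) t"
  by (induction t arbitrary: k) (simp_all add: add.assoc)

lemma vars_relabel: "vars (relabel k t) = [k..<k + length (vars t)]"
proof (induction t arbitrary: k)
  case (Mul s t)
  then show ?case
    using upt_add_eq_append[of k "k + length (vars s)" "length (vars t)"] by (simp add: add.assoc)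
qed simp

text \<open>
  Evaluated at the generator of \<open>Mag\<close>, a word reproduces its own bracketing.  Hence, once its
  variables are put back, every word is its own value, and so lies in the suboperad generated by
  \<open>x\<^sub>1 x\<^sub>2\<close>.
\<close>

lemma planar_eval_Mag:
  "planar_eval Mag (wd (x\<^sub>1 \<cdot> x\<^sub>2)) t = (wd (relabel 1 t) :: nat word \<Rightarrow>\<^sub>0 'k::field)"
proof (induction t)
  case (Var v)
  show ?case by simp
next
  case (Mul s t)
  let ?p = "length (vars s)" and ?q = "length (vars t)"
  have t: "graft ?q 2 (x\<^sub>1 \<cdot> x\<^sub>2) (relabel 1 t) = x\<^sub>1 \<cdot> relabel 2 t"
    by (simp add: relabel_Suc skip_block_def numeral_2_eq_2)
  have ge: "2 \<le> v" if "v \<in> set (vars (relabel (2::nat) t))" for v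
    using that by (auto simp: vars_relabel)
  then have "graft ?p 1 (relabel 2 t) (relabel 1 s) = map_word (skip_block ?p 1) (relabel 2 t)"
    by (intro graft_eq_map_word) fastforce
  also have "\<dots> = map_word ((+) (?p - 1)) (relabel 2 t)"
    using ge length_vars_ge_one[of s] by (intro map_word_cong_vars) (fastforce simp: skip_block_def)
  also have "\<dots> = relabel (1 + ?p) t"
    using length_vars_ge_one[of s] by (simp add: relabel_shift)
  finally have "graft ?p 1 (relabel 2 t) (relabel 1 s) = relabel (1 + ?p) t" .
  then show ?case
    by (simp only: planar_eval.simps Mul.IH Mag_pcomp_wd t)
      (simp only: graft.simps(2) graft_Var_left relabel.simps)
qed

lemma word_eval_Mag:
  "t \<in> multilinear_words n \<Longrightarrow> word_eval Mag (wd (x\<^sub>1 \<cdot> x\<^sub>2)) n t = (wd t :: nat word \<Rightarrow>\<^sub>0 'k::field)"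
  unfolding word_eval_def planar_eval_Mag Mag_act_wd
  by (subst map_word_relabel) (auto simp: leaf_perm_def)

lemma hom_planar_eval:
  assumes P: "operad P" and \<phi>: "operad_hom P Q \<phi>" and a: "a \<in> elems P 2"
  shows "\<phi> (length (vars t)) (planar_eval P a t) = planar_eval Q (\<phi> 2 a) t"
proof (induction t)
  case (Var v)
  show ?case using hom_ident[OF \<phi>] by simp
next
  case (Mul s t)
  interpret operad P by fact
  let ?p = "length (vars s)" and ?q = "length (vars t)"
  note closed = planar_eval_closed[OF a]
  have two: "2 \<in> {1..2::nat}" and one: "1 \<in> {1..?q + 1}" by simp_all
  have top: "pcomp P 2 ?q 2 a (planar_eval P a t) \<in> elems P (?q + 1)"
    using pcomp_closed[OF two length_vars_ge_one a closed[of t]] by simp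
  have "\<phi> (?q + 1) (pcomp P 2 ?q 2 a (planar_eval P a t)) =
      pcomp Q 2 ?q 2 (\<phi> 2 a) (planar_eval Q (\<phi> 2 a) t)"
    using hom_pcomp[OF \<phi> length_vars_ge_one two a closed[of t]] Mul.IH by simp
  moreover have "\<phi> (?q + 1 + ?p - 1) (pcomp P (?q + 1) ?p 1 (pcomp P 2 ?q 2 a (planar_eval P a t)) (planar_eval P a s)) =
      pcomp Q (?q + 1) ?p 1 (\<phi> (?q + 1) (pcomp P 2 ?q 2 a (planar_eval P a t))) (planar_eval Q (\<phi> 2 a) s)"
    using hom_pcomp[OF \<phi> length_vars_ge_one one top closed[of s]] Mul.IH by simp
  ultimately show ?case by (simp add: add.commute)
qed

text \<open>
  Morphisms commute with evaluation and every word is its own value at the generator, so a morphism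
  is determined by the image of the generator.
\<close>

theorem Mag_hom_unique:
  assumes P: "operad (P :: ('k::field, 'a) operad)"
    and \<phi>: "operad_hom Mag P \<phi>" and \<psi>: "operad_hom Mag P \<psi>"
    and eq: "\<phi> 2 (wd (x\<^sub>1 \<cdot> x\<^sub>2)) = \<psi> 2 (wd (x\<^sub>1 \<cdot> x\<^sub>2))"
  shows "hom_eq Mag \<phi> \<psi>"
proof -
  interpret M: operad "Mag :: ('k, nat word \<Rightarrow>\<^sub>0 'k) operad" by (rule operad_Mag)
  interpret operad P by fact
  let ?a = "wd (x\<^sub>1 \<cdot> x\<^sub>2) :: nat word \<Rightarrow>\<^sub>0 'k"
  have a: "?a \<in> elems Mag 2" using generator_multilinear by simp
  have word: "\<chi> n (wd t) = word_eval P (\<chi> 2 ?a) n t"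
    if \<chi>: "operad_hom Mag P \<chi>" and n: "1 \<le> n" and t: "t \<in> multilinear_words n" for \<chi> n t
  proof -
    have len: "length (vars t) = n" by (rule length_vars_multilinear[OF t])
    have "\<chi> n (wd t) = \<chi> n (act Mag n (leaf_perm t) (planar_eval Mag ?a t))"
      by (simp only: word_eval_Mag[OF t, unfolded word_eval_def])
    also have "\<dots> = act P n (leaf_perm t) (\<chi> n (planar_eval Mag ?a t))"
      using hom_act[OF \<chi> n leaf_perm_permutes[OF t]] M.planar_eval_closed[OF a, of t] len by simp
    also have "\<dots> = word_eval P (\<chi> 2 ?a) n t"
      using hom_planar_eval[OF operad_Mag \<chi> a, of t] len by (simp add: word_eval_def)
    finally show ?thesis .
  qed
  show ?thesis
    unfolding hom_eq_def
  proof (intro allI impI ballI)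
    fix n and f :: "nat word \<Rightarrow>\<^sub>0 'k"
    assume n: "1 \<le> n" and f: "f \<in> elems Mag n"
    show "\<phi> n f = \<psi> n f"
      by (rule linear_map_Mag_eqI[OF cpt_module[OF n] hom_linear[OF \<phi> n] hom_linear[OF \<psi> n] _ f])
        (simp only: word[OF \<phi> n] word[OF \<psi> n] eq)
  qed
qed


section \<open>Quotients and presentations\<close>

text \<open>
  The operad axioms are identities, closure conditions and the existence of negatives, and all of
  these are inherited by a surjective image.
\<close>

lemma operad_surjective_image:
  fixes P :: "('k::field, 'a) operad" and Q :: "('k, 'b) operad"
  assumes P: "operad P" and q: "operad_hom P Q q"
    and surj: "\<And>n. 1 \<le> n \<Longrightarrow> elems Q n = q n ` elems P n"
    and zero: "\<And>n. 1 \<le> n \<Longrightarrow> q n \<zero>\<^bsub>cpt P n\<^esub> = \<zero>\<^bsub>cpt Q n\<^esub>"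
  shows "operad Q"
proof -
  interpret operad P by fact
  have lift: "\<exists>y\<in>elems P n. q n y = x" if "1 \<le> n" "x \<in> elems Q n" for n x
    using surj[OF that(1)] that(2) by auto
  show ?thesis
  proof (rule operad.intro)
    fix n :: nat assume n: "1 \<le> n"
    note V = vector_space_onD[OF cpt_module[OF n]]
    interpret V: abelian_group "cpt P n" by (rule V(1))
    note q_simps = hom_add[OF q n, symmetric] hom_smult[OF q n, symmetric] zero[OF n, symmetric]
    show "vector_space_on (cpt Q n)"
    proof (rule vector_space_onI)
      show "abelian_group (cpt Q n)"
      proof (rule abelian_groupI)
        fix x assume "x \<in> elems Q n"
        then obtain y where y: "y \<in> elems P n" "x = q n y" using surj[OF n] by auto
        then show "\<exists>z\<in>elems Q n. z \<oplus>\<^bsub>cpt Q n\<^esub> x = \<zero>\<^bsub>cpt Q n\<^esub>"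
          by (intro bexI[of _ "q n (\<ominus>\<^bsub>cpt P n\<^esub> y)"])
            (simp_all add: q_simps surj[OF n] V.l_neg)
      qed (auto simp: surj[OF n] q_simps V.a_ac)
    qed (auto simp: surj[OF n] q_simps V(2-8))
  next
    fix n :: nat and \<sigma> assume n: "1 \<le> n" and \<sigma>: "\<sigma> permutes {1..n}"
    note V = vector_space_onD[OF cpt_module[OF n]]
    note q_simps = hom_add[OF q n, symmetric] hom_smult[OF q n, symmetric]
      hom_act[OF q n \<sigma>, symmetric]
    show "linear_map (cpt Q n) (cpt Q n) (act Q n \<sigma>)"
      by (rule linear_mapI)
        (auto simp: surj[OF n] q_simps V linear_mapD[OF act_linear[OF n \<sigma>]] act_closed[OF n \<sigma>])
  next
    fix n :: nat and f \<sigma> \<tau> assume n: "1 \<le> n" and f: "f \<in> elems Q n"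
    show "act Q n id f = f"
      using f act_id[OF n] by (auto simp: surj[OF n] hom_act[OF q n permutes_id, symmetric])
    show "pcomp Q 1 n 1 (ident Q) f = f"
      using lift[OF n f] hom_pcomp[OF q n, of 1 1 "ident P"] ident_left[OF n] ident_closed hom_ident[OF q]
      by auto
    assume \<sigma>: "\<sigma> permutes {1..n}" and \<tau>: "\<tau> permutes {1..n}"
    show "act Q n (\<sigma> \<circ> \<tau>) f = act Q n \<sigma> (act Q n \<tau> f)"
      using f act_comp[OF n \<sigma> \<tau>]
      by (auto simp: surj[OF n] hom_act[OF q n permutes_compose[OF \<tau> \<sigma>], symmetric]
          hom_act[OF q n \<sigma>, symmetric] hom_act[OF q n \<tau>, symmetric] act_closed[OF n \<tau>])
  next
    show "ident Q \<in> elems Q 1"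
      using hom_closed[OF q _ ident_closed] hom_ident[OF q] by simp
  next
    fix i n :: nat and f assume i: "i \<in> {1..n}" and f: "f \<in> elems Q n"
    then have n: "1 \<le> n" by simp
    show "pcomp Q n 1 i f (ident Q) = f"
      using lift[OF n f] hom_pcomp[OF q _ i, of 1 _ "ident P"] ident_right[OF i] ident_closed hom_ident[OF q]
      by auto
  next
    fix i m n :: nat and f g \<sigma> \<tau>
    assume i: "i \<in> {1..m}" and n: "1 \<le> n"
    then have m: "1 \<le> m" and mn: "1 \<le> m + n - 1" by auto
    note Vm = vector_space_onD[OF cpt_module[OF m]] and Vn = vector_space_onD[OF cpt_module[OF n]]
    note q_simps = hom_add[OF q m, symmetric] hom_smult[OF q m, symmetric]
      hom_add[OF q n, symmetric] hom_smult[OF q n, symmetric]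
      hom_add[OF q mn, symmetric] hom_smult[OF q mn, symmetric]
      hom_pcomp[OF q n i, symmetric]
    show "linear_map (cpt Q m) (cpt Q (m + n - 1)) (\<lambda>f. pcomp Q m n i f g)" if g: "g \<in> elems Q n"
    proof -
      obtain y where y: "y \<in> elems P n" "q n y = g" using lift[OF n g] by blast
      show ?thesis unfolding y(2)[symmetric]
        by (rule linear_mapI)
          (auto simp del: One_nat_def simp: surj[OF m] surj[OF mn] q_simps y(1) Vm pcomp_closed[OF i n]
            linear_map_add[OF pcomp_linear_left[OF i n y(1)]] linear_map_smult[OF pcomp_linear_left[OF i n y(1)]])
    qed
    show "linear_map (cpt Q n) (cpt Q (m + n - 1)) (\<lambda>g. pcomp Q m n i f g)" if f: "f \<in> elems Q m"
    proof -
      obtain y where y: "y \<in> elems P m" "q m y = f" using lift[OF m f] by blast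
      show ?thesis unfolding y(2)[symmetric]
        by (rule linear_mapI)
          (auto simp del: One_nat_def simp: surj[OF n] surj[OF mn] q_simps y(1) Vn pcomp_closed[OF i n]
            linear_map_add[OF pcomp_linear_right[OF i n y(1)]] linear_map_smult[OF pcomp_linear_right[OF i n y(1)]])
    qed
    assume \<sigma>: "\<sigma> permutes {1..m}" and \<tau>: "\<tau> permutes {1..n}"
      and f: "f \<in> elems Q m" and g: "g \<in> elems Q n"
    obtain f' where f': "f' \<in> elems P m" "f = q m f'" using lift[OF m f] by blast
    obtain g' where g': "g' \<in> elems P n" "g = q n g'" using lift[OF n g] by blast
    have \<sigma>i: "\<sigma> i \<in> {1..m}" using permutes_in_image[OF \<sigma>] i by blast
    have "pcomp Q m n (\<sigma> i) (act Q m \<sigma> f) (act Q n \<tau> g) =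
        q (m + n - 1) (pcomp P m n (\<sigma> i) (act P m \<sigma> f') (act P n \<tau> g'))"
      unfolding hom_pcomp[OF q n \<sigma>i act_closed[OF m \<sigma> f'(1)] act_closed[OF n \<tau> g'(1)]]
        hom_act[OF q m \<sigma> f'(1)] hom_act[OF q n \<tau> g'(1)] f'(2) g'(2) ..
    also have "\<dots> = act Q (m + n - 1) (block_perm n i \<sigma> \<tau>) (pcomp Q m n i f g)"
      unfolding equivariant[OF i n \<sigma> \<tau> f'(1) g'(1)]
        hom_act[OF q mn block_perm_permutes[OF i n \<sigma> \<tau>] pcomp_closed[OF i n f'(1) g'(1)]]
        hom_pcomp[OF q n i f'(1) g'(1)] f'(2) g'(2) ..
    finally show "pcomp Q m n (\<sigma> i) (act Q m \<sigma> f) (act Q n \<tau> g) =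
        act Q (m + n - 1) (block_perm n i \<sigma> \<tau>) (pcomp Q m n i f g)" .
  next
    fix i j l m n :: nat and f g h
    assume i: "i \<in> {1..l}" and j: "j \<in> {1..m}" and n: "1 \<le> n"
      and f: "f \<in> elems Q l" and g: "g \<in> elems Q m" and h: "h \<in> elems Q n"
    have l: "1 \<le> l" and m: "1 \<le> m" and mn: "1 \<le> m + n - 1" and ij: "i + j - 1 \<in> {1..l + m - 1}"
      and arity: "l + (m + n - 1) - 1 = (l + m - 1) + n - 1"
      using i j n by auto
    obtain f' where f': "f' \<in> elems P l" "f = q l f'" using lift[OF l f] by blast
    obtain g' where g': "g' \<in> elems P m" "g = q m g'" using lift[OF m g] by blast
    obtain h' where h': "h' \<in> elems P n" "h = q n h'" using lift[OF n h] by blast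
    show "pcomp Q (l + m - 1) n (i + j - 1) (pcomp Q l m i f g) h =
        pcomp Q l (m + n - 1) i f (pcomp Q m n j g h)"
      using assoc_sequential[OF i j n f'(1) g'(1) h'(1)]
        hom_pcomp[OF q m i f'(1) g'(1)] hom_pcomp[OF q n ij pcomp_closed[OF i m f'(1) g'(1)] h'(1)]
        hom_pcomp[OF q n j g'(1) h'(1)] hom_pcomp[OF q mn i f'(1) pcomp_closed[OF j n g'(1) h'(1)]]
      unfolding f'(2) g'(2) h'(2) arity by metis
  next
    fix i j l m n :: nat and f g h
    assume i: "i \<in> {1..l}" and j: "j \<in> {1..l}" and ij: "i < j" and m: "1 \<le> m" and n: "1 \<le> n"
      and f: "f \<in> elems Q l" and g: "g \<in> elems Q m" and h: "h \<in> elems Q n"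
    have l: "1 \<le> l" and jm: "j + m - 1 \<in> {1..l + m - 1}" and il: "i \<in> {1..l + n - 1}"
      and arity: "(l + n - 1) + m - 1 = (l + m - 1) + n - 1"
      using i j m n by auto
    obtain f' where f': "f' \<in> elems P l" "f = q l f'" using lift[OF l f] by blast
    obtain g' where g': "g' \<in> elems P m" "g = q m g'" using lift[OF m g] by blast
    obtain h' where h': "h' \<in> elems P n" "h = q n h'" using lift[OF n h] by blast
    show "pcomp Q (l + m - 1) n (j + m - 1) (pcomp Q l m i f g) h =
        pcomp Q (l + n - 1) m i (pcomp Q l n j f h) g"
      using assoc_parallel[OF i j ij m n f'(1) g'(1) h'(1)]
        hom_pcomp[OF q m i f'(1) g'(1)] hom_pcomp[OF q n jm pcomp_closed[OF i m f'(1) g'(1)] h'(1)]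
        hom_pcomp[OF q n j f'(1) h'(1)] hom_pcomp[OF q m il pcomp_closed[OF j n f'(1) h'(1)] g'(1)]
      unfolding f'(2) g'(2) h'(2) arity by metis
  qed
qed

locale operadic_ideal = operad P for P :: "('k::field, 'a) operad" +
  fixes I :: "nat \<Rightarrow> 'a set"
  assumes I_subset: "1 \<le> n \<Longrightarrow> I n \<subseteq> elems P n"
    and I_zero: "\<zero>\<^bsub>cpt P n\<^esub> \<in> I n"
    and I_add: "f \<in> I n \<Longrightarrow> g \<in> I n \<Longrightarrow> f \<oplus>\<^bsub>cpt P n\<^esub> g \<in> I n"
    and I_smult: "f \<in> I n \<Longrightarrow> c \<odot>\<^bsub>cpt P n\<^esub> f \<in> I n"
    and I_act: "f \<in> I n \<Longrightarrow> \<sigma> permutes {1..n} \<Longrightarrow> act P n \<sigma> f \<in> I n"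
    and I_pcomp_left: "f \<in> I m \<Longrightarrow> i \<in> {1..m} \<Longrightarrow> 1 \<le> n \<Longrightarrow> g \<in> elems P n \<Longrightarrow>
      pcomp P m n i f g \<in> I (m + n - 1)"
    and I_pcomp_right: "f \<in> elems P m \<Longrightarrow> i \<in> {1..m} \<Longrightarrow> 1 \<le> n \<Longrightarrow> g \<in> I n \<Longrightarrow>
      pcomp P m n i f g \<in> I (m + n - 1)"
begin

abbreviation quot_map :: "nat \<Rightarrow> 'a \<Rightarrow> 'a set" where
  "quot_map n f \<equiv> I n +>\<^bsub>cpt P n\<^esub> f"

lemma I_abelian_subgroup:
  assumes n: "1 \<le> n"
  shows "abelian_subgroup (I n) (cpt P n)"
proof (rule abelian_subgroupI3[OF additive_subgroupI])
  note V = vector_space_onD[OF cpt_module[OF n]]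
  interpret V: abelian_group "cpt P n" by (rule V(1))
  show "abelian_group (cpt P n)" ..
  show "subgroup (I n) (add_monoid (cpt P n))"
  proof (rule V.add.subgroupI)
    show "I n \<subseteq> elems P n" by (rule I_subset[OF n])
    show "I n \<noteq> {}" using I_zero by blast
    show "\<ominus>\<^bsub>cpt P n\<^esub> f \<in> I n" if "f \<in> I n" for f
      using V(11)[of f] I_smult[OF that, of "- 1"] I_subset[OF n] that by auto
    show "f \<oplus>\<^bsub>cpt P n\<^esub> g \<in> I n" if "f \<in> I n" "g \<in> I n" for f g
      using I_add that .
  qed
qed

lemma quot_map_iff:
  "f' \<in> quot_map n f \<longleftrightarrow> (\<exists>r\<in>I n. f' = r \<oplus>\<^bsub>cpt P n\<^esub> f)"
  by (auto simp: a_r_coset_def')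

lemma quot_map_self: "1 \<le> n \<Longrightarrow> f \<in> elems P n \<Longrightarrow> f \<in> quot_map n f"
  using abelian_subgroup.a_rcos_self[OF I_abelian_subgroup] .

lemma quot_map_add_ideal:
  assumes n: "1 \<le> n" and r: "r \<in> I n" and f: "f \<in> elems P n"
  shows "quot_map n (r \<oplus>\<^bsub>cpt P n\<^esub> f) = quot_map n f"
  using abelian_subgroup.a_repr_independence'[OF I_abelian_subgroup[OF n] _ f] quot_map_iff r by blast

text \<open>
  The operations of a quotient are unions over all representatives; if the value does not depend on
  the representative, all members of the union are the same coset.
\<close>

lemma UN_quot_map:
  assumes n: "1 \<le> n" and f: "f \<in> elems P n"
    and h: "\<And>r. r \<in> I n \<Longrightarrow> h (r \<oplus>\<^bsub>cpt P n\<^esub> f) = h f"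
  shows "(\<Union>f'\<in>quot_map n f. h f') = h f"
proof (rule SUP_eq_const)
  show "quot_map n f \<noteq> {}" using quot_map_self[OF n f] by blast
qed (use h in \<open>auto simp: quot_map_iff\<close>)

lemma operad_hom_quot_map: "operad_hom P (quot_operad P I) quot_map"
proof (rule operad_homI)
  fix n :: nat assume n: "1 \<le> n"
  note V = vector_space_onD[OF cpt_module[OF n]]
  show "linear_map (cpt P n) (cpt (quot_operad P I) n) (quot_map n)"
  proof (rule linear_mapI)
    show "quot_map n f \<in> elems (quot_operad P I) n" if "f \<in> elems P n" for f
      using abelian_group.a_rcosetsI[OF V(1) I_subset[OF n] that] by (simp add: quot_operad_def)
    show "quot_map n (f \<oplus>\<^bsub>cpt P n\<^esub> g) = quot_map n f \<oplus>\<^bsub>cpt (quot_operad P I) n\<^esub> quot_map n g"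
      if "f \<in> elems P n" "g \<in> elems P n" for f g
      using abelian_subgroup.a_rcos_sum[OF I_abelian_subgroup[OF n] that] by (simp add: quot_operad_def)
    show "quot_map n (c \<odot>\<^bsub>cpt P n\<^esub> f) = c \<odot>\<^bsub>cpt (quot_operad P I) n\<^esub> quot_map n f"
      if f: "f \<in> elems P n" for c f
    proof -
      have "(\<Union>f'\<in>quot_map n f. quot_map n (c \<odot>\<^bsub>cpt P n\<^esub> f')) = quot_map n (c \<odot>\<^bsub>cpt P n\<^esub> f)"
      proof (rule UN_quot_map[OF n f])
        fix r assume r: "r \<in> I n"
        then have "r \<in> elems P n" using I_subset[OF n] by blast
        then show "quot_map n (c \<odot>\<^bsub>cpt P n\<^esub> (r \<oplus>\<^bsub>cpt P n\<^esub> f)) = quot_map n (c \<odot>\<^bsub>cpt P n\<^esub> f)"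
          using quot_map_add_ideal[OF n I_smult[OF r] V(2)[OF f]] V(6)[OF _ f] by simp
      qed
      then show ?thesis by (simp add: quot_operad_def)
    qed
  qed
next
  fix n :: nat and \<sigma> f assume n: "1 \<le> n" and \<sigma>: "\<sigma> permutes {1..n}" and f: "f \<in> elems P n"
  have "(\<Union>f'\<in>quot_map n f. quot_map n (act P n \<sigma> f')) = quot_map n (act P n \<sigma> f)"
  proof (rule UN_quot_map[OF n f])
    fix r assume r: "r \<in> I n"
    then have "r \<in> elems P n" using I_subset[OF n] by blast
    then show "quot_map n (act P n \<sigma> (r \<oplus>\<^bsub>cpt P n\<^esub> f)) = quot_map n (act P n \<sigma> f)"
      using quot_map_add_ideal[OF n I_act[OF r \<sigma>] act_closed[OF n \<sigma> f]]
        linear_map_add[OF act_linear[OF n \<sigma>] _ f] by simp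
  qed
  then show "quot_map n (act P n \<sigma> f) = act (quot_operad P I) n \<sigma> (quot_map n f)"
    by (simp add: quot_operad_def)
next
  show "quot_map 1 (ident P) = ident (quot_operad P I)"
    by (simp add: quot_operad_def)
next
  fix m n i :: nat and f g
  assume m: "1 \<le> m" and n: "1 \<le> n" and i: "i \<in> {1..m}" and f: "f \<in> elems P m" and g: "g \<in> elems P n"
  have mn: "1 \<le> m + n - 1" using m n by simp
  let ?c = "\<lambda>f g. quot_map (m + n - 1) (pcomp P m n i f g)"
  have right: "(\<Union>g'\<in>quot_map n g. ?c f g') = ?c f g" if f: "f \<in> elems P m" for f
  proof (rule UN_quot_map[OF n g])
    fix r assume r: "r \<in> I n"
    then have "r \<in> elems P n" using I_subset[OF n] by blast
    then show "?c f (r \<oplus>\<^bsub>cpt P n\<^esub> g) = ?c f g"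
      using quot_map_add_ideal[OF mn I_pcomp_right[OF f i n r] pcomp_closed[OF i n f g]]
        linear_map_add[OF pcomp_linear_right[OF i n f] _ g] by simp
  qed
  have left: "(\<Union>f'\<in>quot_map m f. \<Union>g'\<in>quot_map n g. ?c f' g') = (\<Union>g'\<in>quot_map n g. ?c f g')"
  proof (rule UN_quot_map[OF m f])
    fix r assume r: "r \<in> I m"
    then have r': "r \<in> elems P m" using I_subset[OF m] by blast
    then have "r \<oplus>\<^bsub>cpt P m\<^esub> f \<in> elems P m" using vs_add_closed[OF cpt_module[OF m]] f by blast
    then show "(\<Union>g'\<in>quot_map n g. ?c (r \<oplus>\<^bsub>cpt P m\<^esub> f) g') = (\<Union>g'\<in>quot_map n g. ?c f g')"
      unfolding right[OF \<open>r \<oplus>\<^bsub>cpt P m\<^esub> f \<in> elems P m\<close>] right[OF f]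
      using quot_map_add_ideal[OF mn I_pcomp_left[OF r i n g] pcomp_closed[OF i n f g]]
        linear_map_add[OF pcomp_linear_left[OF i n g] r' f] by simp
  qed
  show "?c f g = pcomp (quot_operad P I) m n i (quot_map m f) (quot_map n g)"
    using left right[OF f] by (simp add: quot_operad_def)
qed

lemma elems_quot_operad: "elems (quot_operad P I) n = quot_map n ` elems P n"
  by (auto simp: quot_operad_def A_RCOSETS_def')

lemma quot_map_ideal: "1 \<le> n \<Longrightarrow> r \<in> I n \<Longrightarrow> quot_map n r = \<zero>\<^bsub>cpt (quot_operad P I) n\<^esub>"
  using abelian_subgroup.a_rcos_const[OF I_abelian_subgroup] by (simp add: quot_operad_def)

lemma operad_quot_operad: "operad (quot_operad P I)"
  by (rule operad_surjective_image[OF operad_axioms operad_hom_quot_map])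
    (simp_all add: elems_quot_operad quot_map_ideal I_zero)

text \<open>
  The induced morphism evaluates \<open>\<phi>\<close> at an arbitrary representative of a coset.
\<close>

lemma quot_operad_hom:
  assumes Q: "operad Q" and \<phi>: "operad_hom P Q \<phi>"
    and kills: "\<And>n r. 1 \<le> n \<Longrightarrow> r \<in> I n \<Longrightarrow> \<phi> n r = \<zero>\<^bsub>cpt Q n\<^esub>"
  obtains \<psi> where "operad_hom (quot_operad P I) Q \<psi>"
    and "\<And>n f. 1 \<le> n \<Longrightarrow> f \<in> elems P n \<Longrightarrow> \<psi> n (quot_map n f) = \<phi> n f"
proof
  interpret Q: operad Q by fact
  define \<psi> where "\<psi> n A = \<phi> n (SOME f. f \<in> A)" for n A
  show \<psi>: "\<psi> n (quot_map n f) = \<phi> n f" if n: "1 \<le> n" and f: "f \<in> elems P n" for n f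
  proof -
    have "(SOME f'. f' \<in> quot_map n f) \<in> quot_map n f"
      using quot_map_self[OF n f] by (rule someI)
    then obtain r where r: "r \<in> I n" "(SOME f'. f' \<in> quot_map n f) = r \<oplus>\<^bsub>cpt P n\<^esub> f"
      unfolding quot_map_iff by blast
    interpret Qn: abelian_group "cpt Q n" by (rule vs_abelian_group[OF Q.cpt_module[OF n]])
    show ?thesis
      unfolding \<psi>_def r(2) using r(1) I_subset[OF n] hom_add[OF \<phi> n _ f] kills[OF n r(1)] hom_closed[OF \<phi> n f]
      by auto
  qed
  note q = operad_hom_quot_map
  show "operad_hom (quot_operad P I) Q \<psi>"
  proof (rule operad_homI)
    fix n :: nat assume n: "1 \<le> n"
    note V = vector_space_onD[OF cpt_module[OF n]]
    show "linear_map (cpt (quot_operad P I) n) (cpt Q n) (\<psi> n)"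
      by (rule linear_mapI) (auto simp: elems_quot_operad \<psi>[OF n] hom_closed[OF \<phi> n]
          hom_add[OF q n, symmetric] hom_smult[OF q n, symmetric] V hom_add[OF \<phi> n] hom_smult[OF \<phi> n])
    fix \<sigma> A assume \<sigma>: "\<sigma> permutes {1..n}" and A: "A \<in> elems (quot_operad P I) n"
    then obtain f where f: "f \<in> elems P n" "A = quot_map n f" by (auto simp: elems_quot_operad)
    show "\<psi> n (act (quot_operad P I) n \<sigma> A) = act Q n \<sigma> (\<psi> n A)"
      unfolding f(2) hom_act[OF q n \<sigma> f(1), symmetric] \<psi>[OF n act_closed[OF n \<sigma> f(1)]] \<psi>[OF n f(1)]
      by (rule hom_act[OF \<phi> n \<sigma> f(1)])
  next
    show "\<psi> 1 (ident (quot_operad P I)) = ident Q"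
      using \<psi>[OF _ ident_closed] hom_ident[OF q] hom_ident[OF \<phi>] by simp
  next
    fix m n i :: nat and A B
    assume m: "1 \<le> m" and n: "1 \<le> n" and i: "i \<in> {1..m}"
      and A: "A \<in> elems (quot_operad P I) m" and B: "B \<in> elems (quot_operad P I) n"
    obtain f where f: "f \<in> elems P m" "A = quot_map m f" using A by (auto simp: elems_quot_operad)
    obtain g where g: "g \<in> elems P n" "B = quot_map n g" using B by (auto simp: elems_quot_operad)
    have mn: "1 \<le> m + n - 1" using m n by simp
    show "\<psi> (m + n - 1) (pcomp (quot_operad P I) m n i A B) = pcomp Q m n i (\<psi> m A) (\<psi> n B)"
      unfolding f(2) g(2) hom_pcomp[OF q n i f(1) g(1), symmetric]
        \<psi>[OF mn pcomp_closed[OF i n f(1) g(1)]] \<psi>[OF m f(1)] \<psi>[OF n g(1)]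
      by (rule hom_pcomp[OF \<phi> n i f(1) g(1)])
  qed
qed

end

lemma (in operad) operadic_ideal_operad_ideal:
  assumes R: "\<And>n. R n \<subseteq> elems P n"
  shows "operadic_ideal P (operad_ideal P R)"
proof
  fix n :: nat assume "1 \<le> n"
  moreover have "f \<in> elems P n" if "in_ideal P R n f" "1 \<le> n" for f
    using that
  proof (induction rule: in_ideal.induct)
    case (pcomp_left m f i n g)
    then show ?case by (intro pcomp_closed) auto
  next
    case (pcomp_right f m i n g)
    then show ?case by (intro pcomp_closed) auto
  qed (use R in \<open>auto simp del: One_nat_def intro: act_closed vs_zero_closed[OF cpt_module]
      vs_add_closed[OF cpt_module] vs_smult_closed[OF cpt_module]\<close>)
  ultimately show "operad_ideal P R n \<subseteq> elems P n"
    by (auto simp: operad_ideal_def)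
qed (auto simp: operad_ideal_def simp del: One_nat_def atLeastAtMost_iff intro: in_ideal.intros)

text \<open>
  The kernel of a morphism is an ideal, so it contains the ideal generated by any of its subsets.
\<close>

lemma hom_kills_operad_ideal:
  assumes P: "operad P" and Q: "operad Q" and \<phi>: "operad_hom P Q \<phi>"
    and R: "\<And>n. R n \<subseteq> elems P n"
    and kills: "\<And>n r. r \<in> R n \<Longrightarrow> \<phi> n r = \<zero>\<^bsub>cpt Q n\<^esub>"
    and n: "1 \<le> n" and r: "r \<in> operad_ideal P R n"
  shows "\<phi> n r = \<zero>\<^bsub>cpt Q n\<^esub>"
proof -
  interpret P: operad P by fact
  interpret Q: operad Q by fact
  interpret operadic_ideal P "operad_ideal P R"
    by (rule P.operadic_ideal_operad_ideal[OF R])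
  have closed: "f \<in> elems P n" if "in_ideal P R n f" "1 \<le> n" for n f
    using I_subset[OF that(2)] that(1) by (auto simp: operad_ideal_def)
  have "in_ideal P R n r" using r by (simp add: operad_ideal_def)
  then show ?thesis
    using n
  proof (induction rule: in_ideal.induct)
    case (generator f n)
    then show ?case using kills by blast
  next
    case (zero n)
    then show ?case
      using linear_map_zero[OF hom_linear[OF \<phi>]] P.cpt_module Q.cpt_module by blast
  next
    case (add n f g)
    interpret Qn: abelian_group "cpt Q n" by (rule vs_abelian_group[OF Q.cpt_module[OF add.prems]])
    show ?case using add closed hom_add[OF \<phi>] by simp
  next
    case (smult n f c)
    then show ?case
      using closed hom_smult[OF \<phi>] vs_smult_zero_right[OF Q.cpt_module] by simp
  next
    case (act n f \<sigma>)
    then show ?case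
      using closed hom_act[OF \<phi>] linear_map_zero[OF Q.act_linear Q.cpt_module Q.cpt_module] by simp
  next
    case (pcomp_left m f i n g)
    then have m: "1 \<le> m" by simp
    have "linear_map (cpt Q m) (cpt Q (m + n - 1)) (\<lambda>f. pcomp Q m n i f (\<phi> n g))"
      by (rule Q.pcomp_linear_left) (use pcomp_left hom_closed[OF \<phi>] in auto)
    from linear_map_zero[OF this Q.cpt_module[OF m] Q.cpt_module[OF pcomp_left.prems]]
    show ?case
      using hom_pcomp[OF \<phi> pcomp_left.hyps(3,2) closed[OF pcomp_left.hyps(1) m] pcomp_left.hyps(4)]
        pcomp_left.IH[OF m] by simp
  next
    case (pcomp_right f m i n g)
    then have m: "1 \<le> m" by simp
    have "linear_map (cpt Q n) (cpt Q (m + n - 1)) (\<lambda>g. pcomp Q m n i (\<phi> m f) g)"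
      by (rule Q.pcomp_linear_right) (use pcomp_right hom_closed[OF \<phi> m] in auto)
    from linear_map_zero[OF this Q.cpt_module[OF pcomp_right.hyps(3)] Q.cpt_module[OF pcomp_right.prems]]
    show ?case
      using hom_pcomp[OF \<phi> pcomp_right.hyps(3,2,1) closed[OF pcomp_right.hyps(4,3)]]
        pcomp_right.IH[OF pcomp_right.hyps(3)] by simp
  qed
qed

locale operad_presentation =
  fixes R :: "nat \<Rightarrow> (nat word \<Rightarrow>\<^sub>0 'k::field) set"
  assumes R_subset: "R n \<subseteq> elems Mag n"
begin

sublocale operadic_ideal Mag "operad_ideal Mag R"
  by (rule operad.operadic_ideal_operad_ideal[OF operad_Mag R_subset])

lemma operad_presented: "operad (presented R)"
  unfolding presented_def by (rule operad_quot_operad)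

lemma operad_hom_presented_class: "operad_hom Mag (presented R) (presented_class R)"
  using operad_hom_quot_map unfolding presented_def presented_class_def[abs_def] .

lemma elems_presented: "elems (presented R) n = presented_class R n ` elems Mag n"
  unfolding presented_def presented_class_def by (rule elems_quot_operad)

lemma presented_class_relation:
  assumes "1 \<le> n" "r \<in> R n"
  shows "presented_class R n r = \<zero>\<^bsub>cpt (presented R) n\<^esub>"
  unfolding presented_def presented_class_def
  by (rule quot_map_ideal[OF assms(1)]) (simp add: operad_ideal_def in_ideal.generator assms(2))

lemma presented_hom:
  assumes Q: "operad Q" and \<phi>: "operad_hom Mag Q \<phi>"
    and kills: "\<And>n r. r \<in> R n \<Longrightarrow> \<phi> n r = \<zero>\<^bsub>cpt Q n\<^esub>"
  obtains \<psi> where "operad_hom (presented R) Q \<psi>"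
    and "\<And>n f. 1 \<le> n \<Longrightarrow> f \<in> elems Mag n \<Longrightarrow> \<psi> n (presented_class R n f) = \<phi> n f"
  using quot_operad_hom[OF Q \<phi> hom_kills_operad_ideal[OF operad_Mag Q \<phi> R_subset kills]]
  unfolding presented_def presented_class_def by blast

lemma presented_hom_unique:
  assumes Q: "operad Q" and \<phi>: "operad_hom (presented R) Q \<phi>" and \<psi>: "operad_hom (presented R) Q \<psi>"
    and eq: "\<phi> 2 (presented_class R 2 (wd (x\<^sub>1 \<cdot> x\<^sub>2))) = \<psi> 2 (presented_class R 2 (wd (x\<^sub>1 \<cdot> x\<^sub>2)))"
  shows "hom_eq (presented R) \<phi> \<psi>"
proof -
  have "hom_eq Mag (\<lambda>n f. \<phi> n (presented_class R n f)) (\<lambda>n f. \<psi> n (presented_class R n f))"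
    by (rule Mag_hom_unique[OF Q operad_hom_compose[OF operad_hom_presented_class \<phi>]
          operad_hom_compose[OF operad_hom_presented_class \<psi>] eq])
  then show ?thesis
    by (auto simp: hom_eq_def elems_presented)
qed

end


section \<open>Commutator and anticommutator\<close>

abbreviation commutator :: "nat word \<Rightarrow>\<^sub>0 'k::field" where
  "commutator \<equiv> wd (x\<^sub>1 \<cdot> x\<^sub>2) - wd (x\<^sub>2 \<cdot> x\<^sub>1)"

abbreviation anticommutator :: "nat word \<Rightarrow>\<^sub>0 'k::field" where
  "anticommutator \<equiv> wd (x\<^sub>1 \<cdot> x\<^sub>2) + wd (x\<^sub>2 \<cdot> x\<^sub>1)"

abbreviation jacobi :: "nat word \<Rightarrow>\<^sub>0 'k::field" where
  "jacobi \<equiv> wd ((x\<^sub>1 \<cdot> x\<^sub>2) \<cdot> x\<^sub>3) + wd ((x\<^sub>2 \<cdot> x\<^sub>3) \<cdot> x\<^sub>1) + wd ((x\<^sub>3 \<cdot> x\<^sub>1) \<cdot> x\<^sub>2)"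

abbreviation swap :: "nat \<Rightarrow> nat" where
  "swap \<equiv> transpose 1 2"

abbreviation cycle :: "nat \<Rightarrow> nat" where
  "cycle \<equiv> transpose 1 2 \<circ> transpose 2 3"

lemma swap_permutes: "swap permutes {1..2}"
  by (rule permutes_swap_id) simp_all

lemma cycle_permutes: "cycle permutes {1..3}"
  by (intro permutes_compose permutes_swap_id) simp_all

lemma Mag_diff_closed: "f \<in> elems Mag n \<Longrightarrow> g \<in> elems Mag n \<Longrightarrow> f - g \<in> elems Mag n"
  using keys_diff[of f g] by auto

lemma Mag_add_closed: "f \<in> elems Mag n \<Longrightarrow> g \<in> elems Mag n \<Longrightarrow> f + g \<in> elems Mag n"
  using Poly_Mapping.keys_add[of f g] by auto

lemma binary_words_closed:
  "wd (x\<^sub>1 \<cdot> x\<^sub>2) \<in> elems Mag 2" "wd (x\<^sub>2 \<cdot> x\<^sub>1) \<in> elems Mag 2"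
  "commutator \<in> elems Mag 2" "anticommutator \<in> elems Mag 2"
proof -
  show words: "wd (x\<^sub>1 \<cdot> x\<^sub>2) \<in> elems Mag 2" "wd (x\<^sub>2 \<cdot> x\<^sub>1) \<in> elems Mag 2"
    by (auto simp: multilinear_words_def)
  show "commutator \<in> elems Mag 2" "anticommutator \<in> elems Mag 2"
    by (intro Mag_diff_closed Mag_add_closed words)+
qed

lemma ternary_words_closed:
  assumes "distinct [i, j, k]" "{i, j, k} = {1..3}"
  shows "wd ((Var i \<cdot> Var j) \<cdot> Var k) \<in> elems Mag 3" "wd (Var i \<cdot> (Var j \<cdot> Var k)) \<in> elems Mag 3"
  using assms by (auto simp: multilinear_words_def)

lemma linear_map_Mag_diff:
  assumes "linear_map (cpt Mag m) (cpt Mag n) h" "f \<in> elems Mag m" "g \<in> elems Mag m"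
  shows "h (f - g) = h f - h g"
  using linear_map_add[OF assms(1) Mag_diff_closed[OF assms(2,3)] assms(3)] by (simp add: algebra_simps)

interpretation Lie: operad_presentation Lie_rels
  by standard (auto simp: Lie_rels_def multilinear_words_def dest!: subsetD[OF Poly_Mapping.keys_add])

interpretation Com: operad_presentation Com_rels
  by standard (auto simp: Com_rels_def multilinear_words_def dest!: subsetD[OF keys_diff])

lemma Mag_hom_swap:
  assumes "operad_hom Mag P \<phi>"
  shows "\<phi> 2 (wd (x\<^sub>2 \<cdot> x\<^sub>1)) = act P 2 swap (\<phi> 2 (wd (x\<^sub>1 \<cdot> x\<^sub>2)))"
  using hom_act[OF assms _ swap_permutes binary_words_closed(1)] by (simp add: Mag_act_wd)

lemma act_swap_commutator: "act Mag 2 swap commutator = - (commutator :: nat word \<Rightarrow>\<^sub>0 'k::field)"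
  using linear_map_Mag_diff[OF Mag_act_linear[OF swap_permutes] binary_words_closed(1,2)]
  by (simp add: Mag_act_wd)

lemma act_swap_anticommutator:
  "act Mag 2 swap anticommutator = (anticommutator :: nat word \<Rightarrow>\<^sub>0 'k::field)"
  using linear_map_add[OF Mag_act_linear[OF swap_permutes] binary_words_closed(1,2)]
  by (simp add: Mag_act_wd add.commute)

text \<open>
  The endomorphisms of \<open>Mag\<close> that expand every product \<open>uv\<close> into \<open>uv - vu\<close> and into \<open>uv + vu\<close>.
\<close>

abbreviation commutator_hom :: "nat \<Rightarrow> (nat word \<Rightarrow>\<^sub>0 'k::field) \<Rightarrow> (nat word \<Rightarrow>\<^sub>0 'k)" where
  "commutator_hom \<equiv> Mag_hom Mag commutator"

abbreviation anticommutator_hom :: "nat \<Rightarrow> (nat word \<Rightarrow>\<^sub>0 'k::field) \<Rightarrow> (nat word \<Rightarrow>\<^sub>0 'k)" where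
  "anticommutator_hom \<equiv> Mag_hom Mag anticommutator"

lemmas commutator_hom = operad.Mag_hom[OF operad_Mag binary_words_closed(3)]
lemmas anticommutator_hom = operad.Mag_hom[OF operad_Mag binary_words_closed(4)]

text \<open>
  The expansion of \<open>[[x\<^sub>1, x\<^sub>2], x\<^sub>3]\<close>.
\<close>

definition double_commutator :: "nat word \<Rightarrow>\<^sub>0 'k::field" where
  "double_commutator = wd ((x\<^sub>1 \<cdot> x\<^sub>2) \<cdot> x\<^sub>3) - wd ((x\<^sub>2 \<cdot> x\<^sub>1) \<cdot> x\<^sub>3)
     - (wd (x\<^sub>3 \<cdot> (x\<^sub>1 \<cdot> x\<^sub>2)) - wd (x\<^sub>3 \<cdot> (x\<^sub>2 \<cdot> x\<^sub>1)))"

lemma commutator_pcomp: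
  "pcomp Mag 2 2 1 commutator commutator = (double_commutator :: nat word \<Rightarrow>\<^sub>0 'k::field)"
proof -
  have one: "1 \<in> {1..2::nat}" and n: "1 \<le> (2::nat)" by simp_all
  note bw = binary_words_closed
  show ?thesis
    unfolding linear_map_Mag_diff[OF Mag_pcomp_linear_left[OF one n bw(3)] bw(1,2)]
      linear_map_Mag_diff[OF Mag_pcomp_linear_right[OF one n bw(1)] bw(1,2)]
      linear_map_Mag_diff[OF Mag_pcomp_linear_right[OF one n bw(2)] bw(1,2)]
      Mag_pcomp_wd double_commutator_def
    by (simp add: skip_block_def)
qed

text \<open>
  The three terms of the Jacobi identity are cyclic shifts of \<open>[[x\<^sub>1, x\<^sub>2], x\<^sub>3]\<close>, which expands into
  four words; the resulting twelve words are those of the Lie-admissible identity.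
\<close>

lemma commutator_hom_jacobi:
  "commutator_hom 3 jacobi = (wd ((x\<^sub>1 \<cdot> x\<^sub>2) \<cdot> x\<^sub>3)
       - (wd ((x\<^sub>2 \<cdot> x\<^sub>1) \<cdot> x\<^sub>3) + wd (x\<^sub>3 \<cdot> (x\<^sub>1 \<cdot> x\<^sub>2)) - wd (x\<^sub>3 \<cdot> (x\<^sub>2 \<cdot> x\<^sub>1))
          - wd ((x\<^sub>2 \<cdot> x\<^sub>3) \<cdot> x\<^sub>1) + wd ((x\<^sub>3 \<cdot> x\<^sub>2) \<cdot> x\<^sub>1)
          + wd (x\<^sub>1 \<cdot> (x\<^sub>2 \<cdot> x\<^sub>3)) - wd (x\<^sub>1 \<cdot> (x\<^sub>3 \<cdot> x\<^sub>2))
          - wd ((x\<^sub>3 \<cdot> x\<^sub>1) \<cdot> x\<^sub>2) + wd ((x\<^sub>1 \<cdot> x\<^sub>3) \<cdot> x\<^sub>2)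
          + wd (x\<^sub>2 \<cdot> (x\<^sub>3 \<cdot> x\<^sub>1)) - wd (x\<^sub>2 \<cdot> (x\<^sub>1 \<cdot> x\<^sub>3))) :: nat word \<Rightarrow>\<^sub>0 'k::field)"
proof -
  let ?\<kappa> = "commutator_hom :: nat \<Rightarrow> (nat word \<Rightarrow>\<^sub>0 'k) \<Rightarrow> _"
  note \<kappa> = commutator_hom(1)
  have three: "{1..3} = {1, 2, 3::nat}" by auto
  note words = ternary_words_closed[unfolded three]
  have one: "1 \<in> {1..2::nat}" and n2: "1 \<le> (2::nat)" and n3: "1 \<le> (3::nat)" by simp_all
  have arity: "2 + 2 - 1 = (3::nat)" by simp
  have "wd ((x\<^sub>1 \<cdot> x\<^sub>2) \<cdot> x\<^sub>3) = pcomp Mag 2 2 1 (wd (x\<^sub>1 \<cdot> x\<^sub>2)) (wd (x\<^sub>1 \<cdot> x\<^sub>2) :: nat word \<Rightarrow>\<^sub>0 'k)"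
    by (simp add: Mag_pcomp_wd skip_block_def)
  then have 1: "?\<kappa> 3 (wd ((x\<^sub>1 \<cdot> x\<^sub>2) \<cdot> x\<^sub>3)) = double_commutator"
    using hom_pcomp[OF \<kappa> n2 one binary_words_closed(1,1)] commutator_pcomp
    unfolding commutator_hom(2) arity by metis
  have cycle: "act Mag 3 cycle (wd a - wd b - (wd c - wd d)) =
      wd (map_word cycle a) - wd (map_word cycle b) - (wd (map_word cycle c) - wd (map_word cycle d) :: nat word \<Rightarrow>\<^sub>0 'k)"
    if "wd a \<in> elems (Mag :: ('k, _) operad) 3" "wd b \<in> elems (Mag :: ('k, _) operad) 3"
      "wd c \<in> elems (Mag :: ('k, _) operad) 3" "wd d \<in> elems (Mag :: ('k, _) operad) 3" for a b c d
    using that by (simp only: linear_map_Mag_diff[OF Mag_act_linear[OF cycle_permutes]] Mag_diff_closed Mag_act_wd)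
  have wcycle: "cycle 1 = 2" "cycle 2 = 3" "cycle 3 = 1"
    by (simp_all add: transpose_def)
  have "?\<kappa> 3 (wd ((x\<^sub>2 \<cdot> x\<^sub>3) \<cdot> x\<^sub>1)) = act Mag 3 cycle (?\<kappa> 3 (wd ((x\<^sub>1 \<cdot> x\<^sub>2) \<cdot> x\<^sub>3)))"
    using hom_act[OF \<kappa> n3 cycle_permutes words(1)[of 1 2 3]]
    by (simp only: Mag_act_wd word.map wcycle) auto
  also have "\<dots> = wd ((x\<^sub>2 \<cdot> x\<^sub>3) \<cdot> x\<^sub>1) - wd ((x\<^sub>3 \<cdot> x\<^sub>2) \<cdot> x\<^sub>1)
      - (wd (x\<^sub>1 \<cdot> (x\<^sub>2 \<cdot> x\<^sub>3)) - wd (x\<^sub>1 \<cdot> (x\<^sub>3 \<cdot> x\<^sub>2)))"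
    unfolding 1 double_commutator_def
    by (subst cycle; ((rule words; force) | simp only: word.map wcycle))
  finally have 2: "?\<kappa> 3 (wd ((x\<^sub>2 \<cdot> x\<^sub>3) \<cdot> x\<^sub>1)) = \<dots>" .
  have "?\<kappa> 3 (wd ((x\<^sub>3 \<cdot> x\<^sub>1) \<cdot> x\<^sub>2)) = act Mag 3 cycle (?\<kappa> 3 (wd ((x\<^sub>2 \<cdot> x\<^sub>3) \<cdot> x\<^sub>1)))"
    using hom_act[OF \<kappa> n3 cycle_permutes words(1)[of 2 3 1]]
    by (simp only: Mag_act_wd word.map wcycle) auto
  also have "\<dots> = wd ((x\<^sub>3 \<cdot> x\<^sub>1) \<cdot> x\<^sub>2) - wd ((x\<^sub>1 \<cdot> x\<^sub>3) \<cdot> x\<^sub>2)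
      - (wd (x\<^sub>2 \<cdot> (x\<^sub>3 \<cdot> x\<^sub>1)) - wd (x\<^sub>2 \<cdot> (x\<^sub>1 \<cdot> x\<^sub>3)))"
    unfolding 2
    by (subst cycle; ((rule words; force) | simp only: word.map wcycle))
  finally have 3: "?\<kappa> 3 (wd ((x\<^sub>3 \<cdot> x\<^sub>1) \<cdot> x\<^sub>2)) = \<dots>" .
  have w: "wd ((x\<^sub>1 \<cdot> x\<^sub>2) \<cdot> x\<^sub>3) \<in> elems (Mag :: ('k, _) operad) 3"
    "wd ((x\<^sub>2 \<cdot> x\<^sub>3) \<cdot> x\<^sub>1) \<in> elems (Mag :: ('k, _) operad) 3"
    "wd ((x\<^sub>3 \<cdot> x\<^sub>1) \<cdot> x\<^sub>2) \<in> elems (Mag :: ('k, _) operad) 3"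
    by (rule words; force)+
  have "?\<kappa> 3 jacobi = ?\<kappa> 3 (wd ((x\<^sub>1 \<cdot> x\<^sub>2) \<cdot> x\<^sub>3)) + ?\<kappa> 3 (wd ((x\<^sub>2 \<cdot> x\<^sub>3) \<cdot> x\<^sub>1)) + ?\<kappa> 3 (wd ((x\<^sub>3 \<cdot> x\<^sub>1) \<cdot> x\<^sub>2))"
    using hom_add[OF \<kappa> n3 Mag_add_closed[OF w(1,2)] w(3)] hom_add[OF \<kappa> n3 w(1,2)] by simp
  also have "\<dots> = double_commutator + (wd ((x\<^sub>2 \<cdot> x\<^sub>3) \<cdot> x\<^sub>1) - wd ((x\<^sub>3 \<cdot> x\<^sub>2) \<cdot> x\<^sub>1)
      - (wd (x\<^sub>1 \<cdot> (x\<^sub>2 \<cdot> x\<^sub>3)) - wd (x\<^sub>1 \<cdot> (x\<^sub>3 \<cdot> x\<^sub>2)))) + (wd ((x\<^sub>3 \<cdot> x\<^sub>1) \<cdot> x\<^sub>2) - wd ((x\<^sub>1 \<cdot> x\<^sub>3) \<cdot> x\<^sub>2)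
      - (wd (x\<^sub>2 \<cdot> (x\<^sub>3 \<cdot> x\<^sub>1)) - wd (x\<^sub>2 \<cdot> (x\<^sub>1 \<cdot> x\<^sub>3))))"
    unfolding 1 2 3 ..
  finally show ?thesis
    unfolding double_commutator_def by (simp add: algebra_simps)
qed

lemma Lie_adm_rels_eq: "Lie_adm_rels = (\<lambda>_. {})(3 := {commutator_hom 3 jacobi})"
  unfolding Lie_adm_rels_def commutator_hom_jacobi ..

lemma jacobi_closed: "jacobi \<in> elems Mag 3"
  by (intro Mag_add_closed ternary_words_closed) auto

interpretation Lie_adm: operad_presentation Lie_adm_rels
proof
  fix n show "Lie_adm_rels n \<subseteq> elems Mag n"
    using hom_closed[OF commutator_hom(1) _ jacobi_closed] by (auto simp: Lie_adm_rels_eq)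
qed

text \<open>
  Expanding commutators kills the skew-symmetry relation already in \<open>Mag\<close> and turns the Jacobi
  relation into the Lie-admissible one, so it descends to the quotients.
\<close>

lemma Lie_to_Lie_adm:
  obtains \<pi> :: "nat \<Rightarrow> (nat word \<Rightarrow>\<^sub>0 'k::field) set \<Rightarrow> _"
  where "operad_hom Lie Lie_adm \<pi>"
    and "\<And>n f. 1 \<le> n \<Longrightarrow> f \<in> elems Mag n \<Longrightarrow>
      \<pi> n (presented_class Lie_rels n f) = presented_class Lie_adm_rels n (commutator_hom n f)"
proof (rule Lie.presented_hom[OF Lie_adm.operad_presented
      operad_hom_compose[OF commutator_hom(1) Lie_adm.operad_hom_presented_class]])
  fix n and r :: "nat word \<Rightarrow>\<^sub>0 'k" assume "r \<in> Lie_rels n"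
  then consider "n = 2" "r = anticommutator" | "n = 3" "r = jacobi"
    by (auto simp: Lie_rels_def split: if_splits)
  then show "presented_class Lie_adm_rels n (commutator_hom n r) = \<zero>\<^bsub>cpt (presented Lie_adm_rels) n\<^esub>"
  proof cases
    case 1
    have "commutator_hom 2 r = commutator_hom 2 (wd (x\<^sub>1 \<cdot> x\<^sub>2)) + commutator_hom 2 (wd (x\<^sub>2 \<cdot> x\<^sub>1))"
      using hom_add[OF commutator_hom(1) _ binary_words_closed(1,2)] 1 by simp
    also have "\<dots> = commutator + (- commutator)"
      by (simp only: Mag_hom_swap[OF commutator_hom(1)] commutator_hom(2) act_swap_commutator)
    finally have "commutator_hom 2 r = 0" by simp
    then show ?thesis
      using linear_map_zero[OF hom_linear[OF Lie_adm.operad_hom_presented_class] vector_space_on_Mag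
          operad.cpt_module[OF Lie_adm.operad_presented], of n] 1 by simp
  next
    case 2
    then show ?thesis
      by (intro Lie_adm.presented_class_relation) (simp_all add: Lie_adm_rels_eq)
  qed
qed (use that in \<open>auto simp: Lie_def Lie_adm_def\<close>)

lemma Com_to_Lie_adm:
  obtains \<pi> :: "nat \<Rightarrow> (nat word \<Rightarrow>\<^sub>0 'k::field) set \<Rightarrow> _"
  where "operad_hom Com Lie_adm \<pi>"
    and "\<And>n f. 1 \<le> n \<Longrightarrow> f \<in> elems Mag n \<Longrightarrow>
      \<pi> n (presented_class Com_rels n f) = presented_class Lie_adm_rels n (anticommutator_hom n f)"
proof (rule Com.presented_hom[OF Lie_adm.operad_presented
      operad_hom_compose[OF anticommutator_hom(1) Lie_adm.operad_hom_presented_class]])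
  fix n and r :: "nat word \<Rightarrow>\<^sub>0 'k" assume "r \<in> Com_rels n"
  then have r: "n = 2" "r = commutator"
    by (auto simp: Com_rels_def split: if_splits)
  have "anticommutator_hom 2 r =
      anticommutator_hom 2 (wd (x\<^sub>1 \<cdot> x\<^sub>2)) - anticommutator_hom 2 (wd (x\<^sub>2 \<cdot> x\<^sub>1))"
    unfolding r(2)
    using linear_map_Mag_diff[OF hom_linear[OF anticommutator_hom(1)] binary_words_closed(1,2)] by simp
  also have "\<dots> = anticommutator - anticommutator"
    by (simp only: Mag_hom_swap[OF anticommutator_hom(1)] anticommutator_hom(2) act_swap_anticommutator)
  finally have "anticommutator_hom 2 r = 0" by simp
  then show "presented_class Lie_adm_rels n (anticommutator_hom n r) = \<zero>\<^bsub>cpt (presented Lie_adm_rels) n\<^esub>"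
    using linear_map_zero[OF hom_linear[OF Lie_adm.operad_hom_presented_class] vector_space_on_Mag
        operad.cpt_module[OF Lie_adm.operad_presented], of n] r by simp
qed (use that in \<open>auto simp: Com_def Lie_adm_def\<close>)

text \<open>
  The identity \<open>2 ab = [a, b] + (ab + ba)\<close>: the commutator and the anticommutator generate.
\<close>

lemma generator_from_commutators:
  assumes "(2::'k::field) \<noteq> 0"
  shows "wd (x\<^sub>1 \<cdot> x\<^sub>2) = Poly_Mapping.map ((*) (1 / 2)) (commutator + anticommutator :: nat word \<Rightarrow>\<^sub>0 'k)"
proof (rule poly_mapping_eqI)
  fix t
  have "(1 / 2) * (x - y + (x + y)) = (x::'k)" for x y
    using assms by (simp add: field_simps)
  then show "Poly_Mapping.lookup (wd (x\<^sub>1 \<cdot> x\<^sub>2)) t =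
      Poly_Mapping.lookup (Poly_Mapping.map ((*) (1 / 2)) (commutator + anticommutator :: nat word \<Rightarrow>\<^sub>0 'k)) t"
    by (simp add: lookup_add lookup_minus)
qed

text \<open>
  Exchanging the inputs of \<open>a = (l + c) / 2\<close> gives \<open>(c - l) / 2\<close>, since \<open>l\<close> is skew and \<open>c\<close> symmetric.
  The difference of the two is \<open>l\<close> and their sum is \<open>c\<close>.
\<close>

lemma Mag_hom_half_sum:
  fixes P :: "('k::field, 'a) operad"
  assumes P: "operad P" and two: "(2::'k) \<noteq> 0"
    and l: "l \<in> elems P 2" and skew: "act P 2 swap l = \<ominus>\<^bsub>cpt P 2\<^esub> l"
    and c: "c \<in> elems P 2" and symm: "act P 2 swap c = c"
  defines "a \<equiv> (1 / 2) \<odot>\<^bsub>cpt P 2\<^esub> (l \<oplus>\<^bsub>cpt P 2\<^esub> c)"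
  shows "a \<in> elems P 2" "Mag_hom P a 2 commutator = l" "Mag_hom P a 2 anticommutator = c"
proof -
  interpret operad P by fact
  have n: "1 \<le> (2::nat)" by simp
  note V = vector_space_onD[OF cpt_module[OF n]]
  interpret V: module "ring_of_type_algebra :: 'k ring" "cpt P 2" by (rule cpt_module[OF n])
  show a: "a \<in> elems P 2" unfolding a_def by (intro V l c)
  note \<phi> = operad_hom_Mag_hom[OF a]
  define x where "x = (1 / 2) \<odot>\<^bsub>cpt P 2\<^esub> l"
  define y where "y = (1 / 2) \<odot>\<^bsub>cpt P 2\<^esub> c"
  have x: "x \<in> elems P 2" and y: "y \<in> elems P 2" unfolding x_def y_def by (intro V l c)+
  have half: "1 / 2 + 1 / 2 = (1::'k)" using two by (simp add: field_simps)
  have l': "l = x \<oplus>\<^bsub>cpt P 2\<^esub> x" and c': "c = y \<oplus>\<^bsub>cpt P 2\<^esub> y"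
    unfolding x_def y_def V(5)[OF l, symmetric] V(5)[OF c, symmetric] half using V(8) l c by simp_all
  have a': "a = x \<oplus>\<^bsub>cpt P 2\<^esub> y" unfolding a_def x_def y_def by (rule V(6)[OF l c])
  have "act P 2 swap x = \<ominus>\<^bsub>cpt P 2\<^esub> x"
    unfolding x_def linear_map_smult[OF act_linear[OF n swap_permutes] l] skew
    using V.smult_r_minus[of "1 / 2" l] l by (simp add: ring_of_type_algebra_def)
  moreover have "act P 2 swap y = y"
    unfolding y_def linear_map_smult[OF act_linear[OF n swap_permutes] c] symm ..
  ultimately have "act P 2 swap a = (\<ominus>\<^bsub>cpt P 2\<^esub> x) \<oplus>\<^bsub>cpt P 2\<^esub> y"
    unfolding a' linear_map_add[OF act_linear[OF n swap_permutes] x y] by simp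
  then have b: "Mag_hom P a 2 (wd (x\<^sub>2 \<cdot> x\<^sub>1)) = (\<ominus>\<^bsub>cpt P 2\<^esub> x) \<oplus>\<^bsub>cpt P 2\<^esub> y"
    unfolding Mag_hom_swap[OF \<phi>] Mag_hom_generator[OF a] .
  have "Mag_hom P a 2 commutator \<oplus>\<^bsub>cpt P 2\<^esub> Mag_hom P a 2 (wd (x\<^sub>2 \<cdot> x\<^sub>1)) = a"
    using hom_add[OF \<phi> n binary_words_closed(3,2)] Mag_hom_generator[OF a] by simp
  moreover have "l \<oplus>\<^bsub>cpt P 2\<^esub> Mag_hom P a 2 (wd (x\<^sub>2 \<cdot> x\<^sub>1)) = a"
    unfolding b unfolding l' a' using x y by (simp add: V.M.a_assoc V.M.r_neg2)
  ultimately show "Mag_hom P a 2 commutator = l"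
    using V.M.add.r_cancel hom_closed[OF \<phi> n] binary_words_closed l by metis
  have "Mag_hom P a 2 anticommutator = a \<oplus>\<^bsub>cpt P 2\<^esub> Mag_hom P a 2 (wd (x\<^sub>2 \<cdot> x\<^sub>1))"
    using hom_add[OF \<phi> n binary_words_closed(1,2)] Mag_hom_generator[OF a] by simp
  also have "\<dots> = c"
    unfolding b unfolding c' a' using x y by (simp add: V.M.a_comm[of x y] V.M.a_assoc V.M.r_neg2)
  finally show "Mag_hom P a 2 anticommutator = c" .
qed

lemma Lie_hom_skew:
  fixes P :: "('k::field, 'a) operad"
  assumes P: "operad P" and \<psi>: "operad_hom Lie P \<psi>"
  defines "l \<equiv> \<psi> 2 (presented_class Lie_rels 2 (wd (x\<^sub>1 \<cdot> x\<^sub>2)))"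
  shows "l \<in> elems P 2" "act P 2 swap l = \<ominus>\<^bsub>cpt P 2\<^esub> l"
proof -
  interpret operad P by fact
  have n: "1 \<le> (2::nat)" by simp
  interpret V: abelian_group "cpt P 2" by (rule vs_abelian_group[OF cpt_module[OF n]])
  have \<psi>': "operad_hom (presented Lie_rels) P \<psi>" using \<psi> by (simp add: Lie_def)
  note \<lambda> = operad_hom_compose[OF Lie.operad_hom_presented_class \<psi>']
  show l: "l \<in> elems P 2" unfolding l_def by (rule hom_closed[OF \<lambda> n binary_words_closed(1)])
  have "presented_class Lie_rels 2 anticommutator =
      \<zero>\<^bsub>cpt (presented (Lie_rels :: nat \<Rightarrow> (nat word \<Rightarrow>\<^sub>0 'k) set)) 2\<^esub>"
    by (rule Lie.presented_class_relation) (simp_all add: Lie_rels_def)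
  then have "\<psi> 2 (presented_class Lie_rels 2 anticommutator) = \<zero>\<^bsub>cpt P 2\<^esub>"
    using linear_map_zero[OF hom_linear[OF \<psi>' n] operad.cpt_module[OF Lie.operad_presented n] cpt_module[OF n]]
    by simp
  then have "l \<oplus>\<^bsub>cpt P 2\<^esub> act P 2 swap l = \<zero>\<^bsub>cpt P 2\<^esub>"
    using hom_add[OF \<lambda> n binary_words_closed(1,2)] Mag_hom_swap[OF \<lambda>] by (simp add: l_def)
  then show "act P 2 swap l = \<ominus>\<^bsub>cpt P 2\<^esub> l"
    using V.minus_unique V.minus_equality V.a_comm l act_closed[OF n swap_permutes l] by metis
qed

lemma Com_hom_symmetric:
  fixes P :: "('k::field, 'a) operad"
  assumes P: "operad P" and \<psi>: "operad_hom Com P \<psi>"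
  defines "c \<equiv> \<psi> 2 (presented_class Com_rels 2 (wd (x\<^sub>1 \<cdot> x\<^sub>2)))"
  shows "c \<in> elems P 2" "act P 2 swap c = c"
proof -
  interpret operad P by fact
  have n: "1 \<le> (2::nat)" by simp
  interpret V: abelian_group "cpt P 2" by (rule vs_abelian_group[OF cpt_module[OF n]])
  have \<psi>': "operad_hom (presented Com_rels) P \<psi>" using \<psi> by (simp add: Com_def)
  note \<lambda> = operad_hom_compose[OF Com.operad_hom_presented_class \<psi>']
  show c: "c \<in> elems P 2" unfolding c_def by (rule hom_closed[OF \<lambda> n binary_words_closed(1)])
  have "presented_class Com_rels 2 commutator =
      \<zero>\<^bsub>cpt (presented (Com_rels :: nat \<Rightarrow> (nat word \<Rightarrow>\<^sub>0 'k) set)) 2\<^esub>"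
    by (rule Com.presented_class_relation) (simp_all add: Com_rels_def)
  then have "\<psi> 2 (presented_class Com_rels 2 commutator) = \<zero>\<^bsub>cpt P 2\<^esub>"
    using linear_map_zero[OF hom_linear[OF \<psi>' n] operad.cpt_module[OF Com.operad_presented n] cpt_module[OF n]]
    by simp
  then have "c = \<zero>\<^bsub>cpt P 2\<^esub> \<oplus>\<^bsub>cpt P 2\<^esub> act P 2 swap c"
    using hom_add[OF \<lambda> n binary_words_closed(3,2)] Mag_hom_swap[OF \<lambda>] by (simp add: c_def)
  then show "act P 2 swap c = c"
    using act_closed[OF n swap_permutes c] by simp
qed

section \<open>The free product of Lie and Com\<close>

text \<open>
  Given morphisms from Lie and Com with generators sent to \<open>l\<close> and \<open>c\<close>, send the product to
  \<open>a = (l + c) / 2\<close>.  The composite with the expansion of commutators sends the generator to \<open>l\<close>, so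
  it is the given morphism from Lie, read on words; hence it kills the Jacobi relation.  This says
  that \<open>a\<close> satisfies the Lie-admissible identity.
\<close>

theorem Lie_adm_is_free_product:
  fixes \<pi>\<^sub>1 \<pi>\<^sub>2 :: "nat \<Rightarrow> (nat word \<Rightarrow>\<^sub>0 'k::field) set \<Rightarrow> (nat word \<Rightarrow>\<^sub>0 'k) set"
  assumes two: "(2::'k) \<noteq> 0"
    and \<pi>\<^sub>1: "operad_hom Lie Lie_adm \<pi>\<^sub>1" "\<And>n f. 1 \<le> n \<Longrightarrow> f \<in> elems Mag n \<Longrightarrow>
      \<pi>\<^sub>1 n (presented_class Lie_rels n f) = presented_class Lie_adm_rels n (commutator_hom n f)"
    and \<pi>\<^sub>2: "operad_hom Com Lie_adm \<pi>\<^sub>2" "\<And>n f. 1 \<le> n \<Longrightarrow> f \<in> elems Mag n \<Longrightarrow>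
      \<pi>\<^sub>2 n (presented_class Com_rels n f) = presented_class Lie_adm_rels n (anticommutator_hom n f)"
  shows "is_free_product TYPE('p) Lie Com Lie_adm \<pi>\<^sub>1 \<pi>\<^sub>2"
proof -
  have operads: "operad (Lie :: ('k, _) operad)" "operad (Com :: ('k, _) operad)"
    "operad (Lie_adm :: ('k, _) operad)"
    unfolding Lie_def Com_def Lie_adm_def
    by (rule Lie.operad_presented Com.operad_presented Lie_adm.operad_presented)+
  have n: "1 \<le> (2::nat)" by simp
  let ?g = "wd (x\<^sub>1 \<cdot> x\<^sub>2) :: nat word \<Rightarrow>\<^sub>0 'k"
  let ?q = "presented_class Lie_adm_rels :: nat \<Rightarrow> (nat word \<Rightarrow>\<^sub>0 'k) \<Rightarrow> _"
  note g = binary_words_closed(1)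
  have gen\<^sub>1: "\<pi>\<^sub>1 2 (presented_class Lie_rels 2 ?g) = ?q 2 commutator"
    using \<pi>\<^sub>1(2)[OF n g] by (simp only: commutator_hom(2))
  have gen\<^sub>2: "\<pi>\<^sub>2 2 (presented_class Com_rels 2 ?g) = ?q 2 anticommutator"
    using \<pi>\<^sub>2(2)[OF n g] by (simp only: anticommutator_hom(2))
  have "\<exists>\<psi>. operad_hom Lie_adm P \<psi> \<and>
      hom_eq Lie \<psi>\<^sub>1 (\<lambda>n f. \<psi> n (\<pi>\<^sub>1 n f)) \<and> hom_eq Com \<psi>\<^sub>2 (\<lambda>n f. \<psi> n (\<pi>\<^sub>2 n f)) \<and>
      (\<forall>\<psi>'. operad_hom Lie_adm P \<psi>' \<and> hom_eq Lie \<psi>\<^sub>1 (\<lambda>n f. \<psi>' n (\<pi>\<^sub>1 n f)) \<and>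
        hom_eq Com \<psi>\<^sub>2 (\<lambda>n f. \<psi>' n (\<pi>\<^sub>2 n f)) \<longrightarrow> hom_eq Lie_adm \<psi>' \<psi>)"
    if P: "operad P" and \<psi>\<^sub>1: "operad_hom Lie P \<psi>\<^sub>1" and \<psi>\<^sub>2: "operad_hom Com P \<psi>\<^sub>2"
    for P :: "('k, 'p) operad" and \<psi>\<^sub>1 \<psi>\<^sub>2
  proof -
    interpret operad P by (rule P)
    define l where "l = \<psi>\<^sub>1 2 (presented_class Lie_rels 2 ?g)"
    define c where "c = \<psi>\<^sub>2 2 (presented_class Com_rels 2 ?g)"
    define a where "a = (1 / 2) \<odot>\<^bsub>cpt P 2\<^esub> (l \<oplus>\<^bsub>cpt P 2\<^esub> c)"
    note lc = Lie_hom_skew[OF P \<psi>\<^sub>1, folded l_def] Com_hom_symmetric[OF P \<psi>\<^sub>2, folded c_def]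
    note a = Mag_hom_half_sum[OF P two lc, folded a_def]
    note \<phi> = operad_hom_Mag_hom[OF a(1)]
    have \<psi>\<^sub>1': "operad_hom (presented Lie_rels) P \<psi>\<^sub>1" and \<psi>\<^sub>2': "operad_hom (presented Com_rels) P \<psi>\<^sub>2"
      using \<psi>\<^sub>1 \<psi>\<^sub>2 by (simp_all add: Lie_def Com_def)
    have "hom_eq Mag (\<lambda>n f. Mag_hom P a n (commutator_hom n f)) (\<lambda>n f. \<psi>\<^sub>1 n (presented_class Lie_rels n f))"
      by (rule Mag_hom_unique[OF P operad_hom_compose[OF commutator_hom(1) \<phi>]
            operad_hom_compose[OF Lie.operad_hom_presented_class \<psi>\<^sub>1']])
        (simp only: commutator_hom(2) a(2) l_def)
    then have "Mag_hom P a 3 (commutator_hom 3 jacobi) = \<psi>\<^sub>1 3 (presented_class Lie_rels 3 jacobi)"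
      using hom_eqD[OF _ _ jacobi_closed] by fastforce
    also have "presented_class Lie_rels 3 jacobi = \<zero>\<^bsub>cpt (presented (Lie_rels :: nat \<Rightarrow> (nat word \<Rightarrow>\<^sub>0 'k) set)) 3\<^esub>"
      by (rule Lie.presented_class_relation) (simp_all add: Lie_rels_def)
    also have "\<psi>\<^sub>1 3 \<dots> = \<zero>\<^bsub>cpt P 3\<^esub>"
      by (rule linear_map_zero[OF hom_linear[OF \<psi>\<^sub>1'] operad.cpt_module[OF Lie.operad_presented] cpt_module]) simp_all
    finally have "Mag_hom P a n r = \<zero>\<^bsub>cpt P n\<^esub>" if "r \<in> Lie_adm_rels n" for n r
      using that by (auto simp: Lie_adm_rels_eq split: if_splits)
    from Lie_adm.presented_hom[OF P \<phi> this]
    obtain \<psi> where \<psi>: "operad_hom Lie_adm P \<psi>"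
      and \<psi>q: "\<And>n f. 1 \<le> n \<Longrightarrow> f \<in> elems Mag n \<Longrightarrow> \<psi> n (?q n f) = Mag_hom P a n f"
      unfolding Lie_adm_def by blast
    have "hom_eq (presented Lie_rels) \<psi>\<^sub>1 (\<lambda>n f. \<psi> n (\<pi>\<^sub>1 n f))"
      by (rule Lie.presented_hom_unique[OF P \<psi>\<^sub>1' operad_hom_compose[OF \<pi>\<^sub>1(1)[unfolded Lie_def] \<psi>]])
        (simp only: gen\<^sub>1 \<psi>q[OF n binary_words_closed(3)] a(2) l_def)
    moreover have "hom_eq (presented Com_rels) \<psi>\<^sub>2 (\<lambda>n f. \<psi> n (\<pi>\<^sub>2 n f))"
      by (rule Com.presented_hom_unique[OF P \<psi>\<^sub>2' operad_hom_compose[OF \<pi>\<^sub>2(1)[unfolded Com_def] \<psi>]])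
        (simp only: gen\<^sub>2 \<psi>q[OF n binary_words_closed(4)] a(3) c_def)
    moreover have "hom_eq Lie_adm \<psi>' \<psi>"
      if \<psi>': "operad_hom Lie_adm P \<psi>'" and "hom_eq Lie \<psi>\<^sub>1 (\<lambda>n f. \<psi>' n (\<pi>\<^sub>1 n f))"
        "hom_eq Com \<psi>\<^sub>2 (\<lambda>n f. \<psi>' n (\<pi>\<^sub>2 n f))" for \<psi>'
    proof -
      have "\<psi>' 2 (?q 2 commutator) = l"
        using hom_eqD[OF that(2)[unfolded Lie_def] n hom_closed[OF Lie.operad_hom_presented_class n g]]
        by (simp only: gen\<^sub>1 l_def)
      moreover have "\<psi>' 2 (?q 2 anticommutator) = c"
        using hom_eqD[OF that(3)[unfolded Com_def] n hom_closed[OF Com.operad_hom_presented_class n g]]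
        by (simp only: gen\<^sub>2 c_def)
      \<comment> \<open>The images of commutator and anticommutator are prescribed, and the product is half their sum.\<close>
      moreover note \<chi> = operad_hom_compose[OF Lie_adm.operad_hom_presented_class \<psi>'[unfolded Lie_adm_def]]
      have "\<psi>' 2 (?q 2 ?g) = (1 / 2) \<odot>\<^bsub>cpt P 2\<^esub> (\<psi>' 2 (?q 2 commutator) \<oplus>\<^bsub>cpt P 2\<^esub> \<psi>' 2 (?q 2 anticommutator))"
        using hom_smult[OF \<chi> n Mag_add_closed[OF binary_words_closed(3,4)], of "1 / 2"]
          hom_add[OF \<chi> n binary_words_closed(3,4)] generator_from_commutators[OF two]
        by (simp only: Mag_simps)
      ultimately have "\<psi>' 2 (?q 2 ?g) = \<psi> 2 (?q 2 ?g)"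
        unfolding \<psi>q[OF n g] Mag_hom_generator[OF a(1)] by (simp only: a_def)
      then show ?thesis
        unfolding Lie_adm_def
        by (rule Lie_adm.presented_hom_unique[OF P \<psi>'[unfolded Lie_adm_def] \<psi>[unfolded Lie_adm_def]])
    qed
    ultimately show ?thesis
      using \<psi> unfolding Lie_def Com_def by blast
  qed
  then show ?thesis
    unfolding is_free_product_def using operads \<pi>\<^sub>1(1) \<pi>\<^sub>2(1) by blast
qed

theorem theorem3:
  assumes "CHAR('k::field) \<noteq> 2"
  shows
    "(\<forall>(F :: ('k, 'f) operad) \<pi>\<^sub>1 \<pi>\<^sub>2.
        is_free_product TYPE('f) Lie Com F \<pi>\<^sub>1 \<pi>\<^sub>2 \<and>
        is_free_product TYPE((nat word \<Rightarrow>\<^sub>0 'k) set) Lie Com F \<pi>\<^sub>1 \<pi>\<^sub>2 \<longrightarrow>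
        operad_isomorphic Lie_adm F) \<and>
     (\<exists>\<pi>\<^sub>1 \<pi>\<^sub>2.
        \<pi>\<^sub>1 2 (presented_class Lie_rels 2 (wd (x\<^sub>1 \<cdot> x\<^sub>2))) =
          presented_class Lie_adm_rels 2 (wd (x\<^sub>1 \<cdot> x\<^sub>2) - wd (x\<^sub>2 \<cdot> x\<^sub>1)) \<and>
        \<pi>\<^sub>2 2 (presented_class Com_rels 2 (wd (x\<^sub>1 \<cdot> x\<^sub>2))) =
          presented_class Lie_adm_rels 2 (wd (x\<^sub>1 \<cdot> x\<^sub>2) + wd (x\<^sub>2 \<cdot> x\<^sub>1)) \<and>
        is_free_product TYPE('p) Lie Com (Lie_adm :: ('k, _) operad) \<pi>\<^sub>1 \<pi>\<^sub>2)"
proof -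
  have two: "(2::'k) \<noteq> 0"
  proof
    assume "(2::'k) = 0"
    then have "CHAR('k) dvd 2"
      using of_nat_eq_0_iff_char_dvd[where ?'a = 'k, of 2] by simp
    then have "CHAR('k) = 1 \<or> CHAR('k) = 2"
      by (metis prime_nat_iff two_is_prime_nat)
    then show False
      using assms by simp
  qed
  obtain \<pi>\<^sub>1 :: "nat \<Rightarrow> (nat word \<Rightarrow>\<^sub>0 'k) set \<Rightarrow> _" where \<pi>\<^sub>1: "operad_hom Lie Lie_adm \<pi>\<^sub>1"
    "\<And>n f. 1 \<le> n \<Longrightarrow> f \<in> elems Mag n \<Longrightarrow>
      \<pi>\<^sub>1 n (presented_class Lie_rels n f) = presented_class Lie_adm_rels n (commutator_hom n f)"
    using Lie_to_Lie_adm by blast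
  obtain \<pi>\<^sub>2 :: "nat \<Rightarrow> (nat word \<Rightarrow>\<^sub>0 'k) set \<Rightarrow> _" where \<pi>\<^sub>2: "operad_hom Com Lie_adm \<pi>\<^sub>2"
    "\<And>n f. 1 \<le> n \<Longrightarrow> f \<in> elems Mag n \<Longrightarrow>
      \<pi>\<^sub>2 n (presented_class Com_rels n f) = presented_class Lie_adm_rels n (anticommutator_hom n f)"
    using Com_to_Lie_adm by blast
  note free = Lie_adm_is_free_product[OF two \<pi>\<^sub>1 \<pi>\<^sub>2]
  have "operad_isomorphic Lie_adm F"
    if "is_free_product TYPE('f) Lie Com F \<rho>\<^sub>1 \<rho>\<^sub>2"
      "is_free_product TYPE((nat word \<Rightarrow>\<^sub>0 'k) set) Lie Com F \<rho>\<^sub>1 \<rho>\<^sub>2" for F :: "('k, 'f) operad" and \<rho>\<^sub>1 \<rho>\<^sub>2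
    by (rule free_product_unique[OF free free that])
  moreover have "\<pi>\<^sub>1 2 (presented_class Lie_rels 2 (wd (x\<^sub>1 \<cdot> x\<^sub>2))) = presented_class Lie_adm_rels 2 commutator"
    "\<pi>\<^sub>2 2 (presented_class Com_rels 2 (wd (x\<^sub>1 \<cdot> x\<^sub>2))) = presented_class Lie_adm_rels 2 anticommutator"
    using \<pi>\<^sub>1(2)[OF _ binary_words_closed(1)] \<pi>\<^sub>2(2)[OF _ binary_words_closed(1)]
    by (simp_all only: commutator_hom(2) anticommutator_hom(2))
  ultimately show ?thesis
    using free by blast
qed

end
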